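(* Let $\varepsilon_0$ be the threshold energy. If $u:S^3\to M$ is a $C^1$ associative Smith map with respect to the round metric on $S^3$ and $$\int_{S^3}|du|^3\,d\mu<\varepsilon_0,$$ then $u$ is constant.
   Context: $(M^7,h)$ is a closed (compact, without boundary) smooth oriented Riemannian 7-manifold with a smooth 2-fold vector cross product $J:\Lambda^2TM\to TM$, i.e. $J(x\wedge y)\perp x,y$ and $|J(x\wedge y)|^2=|x\wedge y|^2$ for all tangent vectors $x,y$ at a point. $M$ is smoothly isometrically embedded in $(\mathbb{R}^d,g_{\mathrm{euc}})$. $W^{1,3}(\Omega;M)=\{u\in W^{1,3}(\Omega;\mathbb{R}^d): u(x)\in M\text{ for a.e. }x\}$. For an oriented Riemannian 3-manifold $(\Omega,g)$ let $*:\Lambda^2T\Omega\to T\Omega$ be the Hodge star. A map $u\in W^{1,3}(\Omega;M)$ (respectively $u\in C^1$) is an associative Smith map with respect to $g$ if $J\circ\Lambda^2du=\frac{1}{\sqrt3}|du|\,du\circ *$ almost everywhere (respectively everywhere) on $\Omega$, where $|du|$ is the Hilbert–Schmidt norm with respect to $g$ and $h$. On $S^3$, $|du|$ and the volume measure $d\mu$ are with respect to the round (unit) metric, and $S^3$ carries a fixed orientation. Threshold energy $\varepsilon_0$: let $B(r)\subset\mathbb{R}^3$ be the open ball of radius $r$ about $0$ with standard orientation, $|Du|$ the Euclidean norm of the derivative, and $|\cdot|_{0;A}$ the sup norm on $A$. For $\alpha\in(0,1)$, a pair $\varepsilon_0,\theta\in(0,\frac19)$ is an energy-decay pair if for every smooth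 Riemannian metric $g$ on $B(2)$ with $|g-g_{\mathrm{euc}}|_{0;B(2)}+|Dg|_{0;B(2)}\le\varepsilon_0$ and every associative Smith map $u\in W^{1,3}(B(2);M)$ with respect to $g$ with $\int_{B(2)}|Du|^3dx<\varepsilon_0$ one has $\int_{B(\theta)}|Du|^3dx\le\theta^{3\alpha}\int_{B(2)}|Du|^3dx$. Such pairs exist for every $\alpha\in(0,1)$ and can be chosen depending only on $\alpha$, $M$, $J$ and the embedding. Fix $\alpha\in(\frac34,1)$ and such a pair; its first member $\varepsilon_0$ is the threshold energy. *)

theory Defs
  imports "HOL-Analysis.Analysis"
begin

section \<open>Differentiability classes\<close>

text \<open>Meant for open \<open>U\<close>: \<open>f\<close> is of class \<open>C^k\<close> iff it is differentiable on \<open>U\<close> and all its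
  directional derivatives are of class \<open>C^(k-1)\<close>.\<close>

primrec Ck_open :: "nat \<Rightarrow> 'a::euclidean_space set \<Rightarrow> ('a \<Rightarrow> 'b::real_normed_vector) \<Rightarrow> bool" where
  "Ck_open 0 U f \<longleftrightarrow> continuous_on U f"
| "Ck_open (Suc k) U f \<longleftrightarrow> (\<forall>x\<in>U. f differentiable (at x)) \<and>
     (\<forall>v. Ck_open k U (\<lambda>x. frechet_derivative f (at x) v))"

text \<open>A map on an arbitrary subset of a Euclidean space is of class \<open>C^k\<close> (\<open>k = \<infinity>\<close>: smooth) iff
  locally it extends to a \<open>C^k\<close> map on an open set.  For open sets and for embedded submanifolds
  this is the usual notion.\<close>

definition Ck_map :: "enat \<Rightarrow> 'a::euclidean_space set \<Rightarrow> ('a \<Rightarrow> 'b::real_normed_vector) \<Rightarrow> bool" where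
  "Ck_map k S f \<longleftrightarrow> (\<forall>p\<in>S. \<exists>U F. open U \<and> p \<in> U \<and> (\<forall>j. enat j \<le> k \<longrightarrow> Ck_open j U F) \<and>
     (\<forall>x\<in>S \<inter> U. F x = f x))"


section \<open>Embedded submanifolds\<close>

text \<open>A diffeomorphism from an open subset of \<open>real^'k\<close> onto a relatively open subset of \<open>S\<close>.\<close>

definition local_parametrization ::
    "'a::euclidean_space set \<Rightarrow> (real^'k) set \<Rightarrow> (real^'k \<Rightarrow> 'a) \<Rightarrow> bool" where
  "local_parametrization S V \<phi> \<longleftrightarrow> open V \<and> openin (top_of_set S) (\<phi> ` V) \<and> inj_on \<phi> V \<and>
     Ck_map \<infinity> V \<phi> \<and> Ck_map \<infinity> (\<phi> ` V) (inv_into V \<phi>)"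

definition submanifold :: "'k::finite itself \<Rightarrow> 'a::euclidean_space set \<Rightarrow> bool" where
  "submanifold _ S \<longleftrightarrow>
     (\<forall>p\<in>S. \<exists>V (\<phi> :: real^'k \<Rightarrow> 'a). local_parametrization S V \<phi> \<and> p \<in> \<phi> ` V)"

text \<open>Velocities at \<open>p\<close> of smooth curves in \<open>S\<close>.\<close>

definition tangent_space :: "'a::euclidean_space set \<Rightarrow> 'a \<Rightarrow> 'a set" where
  "tangent_space S p = {v. \<exists>(\<gamma> :: real \<Rightarrow> 'a) \<delta>. 0 < \<delta> \<and> \<gamma> ` {-\<delta><..<\<delta>} \<subseteq> S \<and> \<gamma> 0 = p \<and>
     Ck_map \<infinity> {-\<delta><..<\<delta>} \<gamma> \<and> (\<gamma> has_vector_derivative v) (at 0)}"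

text \<open>An orientation is given by the sets \<open>ori p\<close> of positively oriented frames (ordered bases,
  indexed by \<open>'k\<close>) of the tangent spaces: near every point there is a local parametrization such
  that the positive frames are exactly those whose matrix with respect to the coordinate frame has
  positive determinant.\<close>

definition orientation ::
    "'a::euclidean_space set \<Rightarrow> ('a \<Rightarrow> ('k::finite \<Rightarrow> 'a) set) \<Rightarrow> bool" where
  "orientation S ori \<longleftrightarrow> (\<forall>p\<in>S. \<exists>V \<phi>. local_parametrization S V \<phi> \<and> p \<in> \<phi> ` V \<and>
     (\<forall>x\<in>V. ori (\<phi> x) =
        {\<lambda>i. frechet_derivative \<phi> (at x) (column i A) | A :: real^'k^'k. 0 < det A}))"

definition standard_orientation :: "('k::finite \<Rightarrow> real^'k) set" where
  "standard_orientation = {e. 0 < det (\<chi> i. e i)}"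

text \<open>\<open>\<mu>\<close> is the volume measure of the Riemannian metric induced on the 3-dimensional submanifold
  \<open>S\<close>: in every local parametrization it has the density \<open>sqrt (det (g_ij))\<close>.  These conditions
  determine \<open>\<mu>\<close> uniquely.\<close>

definition volume_measure3 :: "'a::euclidean_space set \<Rightarrow> 'a measure \<Rightarrow> bool" where
  "volume_measure3 S \<mu> \<longleftrightarrow> sets \<mu> = sets (restrict_space borel S) \<and>
     (\<forall>V (\<phi> :: real^3 \<Rightarrow> 'a) A. local_parametrization S V \<phi> \<and> A \<in> sets borel \<and> A \<subseteq> V \<longrightarrow>
        emeasure \<mu> (\<phi> ` A) = (\<integral>\<^sup>+x\<in>A. ennreal (sqrt (det (\<chi> i j.
          frechet_derivative \<phi> (at x) (axis i 1) \<bullet> frechet_derivative \<phi> (at x) (axis j 1)))) \<partial>lborel))"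


section \<open>Vector cross products\<close>

text \<open>A smooth 2-fold vector cross product on \<open>M\<close> with the induced metric.  The bundle map on
  \<open>\<Lambda>^2 TM\<close> is encoded as a smooth family of alternating bilinear maps, \<open>J p x y\<close> being the
  image of \<open>x \<and> y\<close>; the values for vectors not tangent to \<open>M\<close> are irrelevant.  The squared norm
  of \<open>x \<and> y\<close> is the Gram determinant of \<open>x\<close> and \<open>y\<close>.\<close>

definition vector_cross_product ::
    "'a::euclidean_space set \<Rightarrow> ('a \<Rightarrow> 'a \<Rightarrow> 'a \<Rightarrow> 'a) \<Rightarrow> bool" where
  "vector_cross_product M J \<longleftrightarrow>
     (\<forall>p\<in>M. \<forall>x\<in>tangent_space M p. \<forall>y\<in>tangent_space M p.
        J p x y \<in> tangent_space M p \<and>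
        (\<forall>z\<in>tangent_space M p. \<forall>a b. J p (a *\<^sub>R x + b *\<^sub>R z) y = a *\<^sub>R J p x y + b *\<^sub>R J p z y) \<and>
        (\<forall>z\<in>tangent_space M p. \<forall>a b. J p x (a *\<^sub>R y + b *\<^sub>R z) = a *\<^sub>R J p x y + b *\<^sub>R J p x z) \<and>
        J p x x = 0 \<and>
        J p x y \<bullet> x = 0 \<and> J p x y \<bullet> y = 0 \<and>
        (norm (J p x y))\<^sup>2 = (norm x)\<^sup>2 * (norm y)\<^sup>2 - (x \<bullet> y)\<^sup>2) \<and>
     Ck_map \<infinity> {(p, x, y). p \<in> M \<and> x \<in> tangent_space M p \<and> y \<in> tangent_space M p}
       (\<lambda>(p, x, y). J p x y)"


section \<open>The Smith equation\<close>

text \<open>In this section \<open>T\<close> is a 3-dimensional tangent space, \<open>g\<close> an inner product on it and \<open>P\<close> the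
  set of its positively oriented frames.\<close>

definition orthonormal_frame ::
    "'a set \<Rightarrow> ('a \<Rightarrow> 'a \<Rightarrow> real) \<Rightarrow> (3 \<Rightarrow> 'a) \<Rightarrow> bool" where
  "orthonormal_frame T g e \<longleftrightarrow> range e \<subseteq> T \<and> (\<forall>i j. g (e i) (e j) = (if i = j then 1 else 0))"

text \<open>Hilbert--Schmidt norm of \<open>D\<close> with respect to \<open>g\<close> and the Euclidean inner product on the
  target; it does not depend on the orthonormal frame.\<close>

definition hs_norm ::
    "'a set \<Rightarrow> ('a \<Rightarrow> 'a \<Rightarrow> real) \<Rightarrow> ('a \<Rightarrow> 'b::real_normed_vector) \<Rightarrow> real" where
  "hs_norm T g D =
     (THE r. \<exists>e. orthonormal_frame T g e \<and> r = sqrt (\<Sum>i\<in>UNIV. (norm (D (e i)))\<^sup>2))"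

text \<open>The Hodge star of \<open>v \<and> w\<close> is the vector \<open>s\<close> with \<open>g(s,z) = vol(v,w,z)\<close> for all \<open>z\<close>, where the
  volume form is the determinant of the components in any positive orthonormal frame.  In
  particular it maps \<open>e\<^sub>1 \<and> e\<^sub>2\<close> to \<open>e\<^sub>3\<close> for such frames.\<close>

definition hodge_star ::
    "'a::zero set \<Rightarrow> ('a \<Rightarrow> 'a \<Rightarrow> real) \<Rightarrow> (3 \<Rightarrow> 'a) set \<Rightarrow> 'a \<Rightarrow> 'a \<Rightarrow> 'a" where
  "hodge_star T g P v w = (THE s. s \<in> T \<and>
     (\<forall>e\<in>P. orthonormal_frame T g e \<longrightarrow>
        (\<forall>z\<in>T. g s z = det (\<chi> i j. g ((vector [v, w, z] :: 'a^3) $ i) (e j)))))"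

text \<open>The Smith equation at one point, for the cross product \<open>B\<close> on the target tangent space and
  the differential \<open>D\<close>; by linearity it suffices to state it on decomposable bivectors.\<close>

definition smith_equation ::
    "'a::zero set \<Rightarrow> ('a \<Rightarrow> 'a \<Rightarrow> real) \<Rightarrow> (3 \<Rightarrow> 'a) set \<Rightarrow>
     ('b \<Rightarrow> 'b \<Rightarrow> 'b) \<Rightarrow> ('a \<Rightarrow> 'b::real_normed_vector) \<Rightarrow> bool" where
  "smith_equation T g P B D \<longleftrightarrow> (\<forall>v\<in>T. \<forall>w\<in>T.
     B (D v) (D w) = (1 / sqrt 3 * hs_norm T g D) *\<^sub>R D (hodge_star T g P v w))"

text \<open>The differential of a \<open>C^1\<close> map on an embedded submanifold \<open>S\<close>.  On tangent vectors it is
  uniquely determined, and only these values are used below.\<close>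

definition differential ::
    "'a::euclidean_space set \<Rightarrow> ('a \<Rightarrow> 'b::real_normed_vector) \<Rightarrow> 'a \<Rightarrow> 'a \<Rightarrow> 'b" where
  "differential S u x = frechet_derivative u (at x within S)"

text \<open>\<open>C^1\<close> associative Smith maps into \<open>M\<close> from an embedded 3-manifold \<open>S\<close> with the induced metric
  and the orientation \<open>ori\<close>.\<close>

definition C1_smith_map ::
    "'a::euclidean_space set \<Rightarrow> ('a \<Rightarrow> (3 \<Rightarrow> 'a) set) \<Rightarrow>
     'b::euclidean_space set \<Rightarrow> ('b \<Rightarrow> 'b \<Rightarrow> 'b \<Rightarrow> 'b) \<Rightarrow> ('a \<Rightarrow> 'b) \<Rightarrow> bool" where
  "C1_smith_map S ori M J u \<longleftrightarrow> u ` S \<subseteq> M \<and> Ck_map 1 S u \<and>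
     (\<forall>x\<in>S. smith_equation (tangent_space S x) (\<bullet>) (ori x) (J (u x)) (differential S u x))"


section \<open>Sobolev Smith maps and the energy decay\<close>

definition test_function :: "'a::euclidean_space set \<Rightarrow> ('a \<Rightarrow> real) \<Rightarrow> bool" where
  "test_function \<Omega> \<eta> \<longleftrightarrow> Ck_map \<infinity> UNIV \<eta> \<and> (\<exists>K. compact K \<and> K \<subseteq> \<Omega> \<and> (\<forall>x. x \<notin> K \<longrightarrow> \<eta> x = 0))"

text \<open>\<open>u\<close> belongs to \<open>W^(1,3)(\<Omega>;M)\<close> and has the weak derivative \<open>Du\<close>.  Both are given by
  representatives; that of \<open>Du\<close> is chosen linear at every point of \<open>\<Omega>\<close>.\<close>

definition W13 ::
    "'a::euclidean_space set \<Rightarrow> 'b::euclidean_space set \<Rightarrow> ('a \<Rightarrow> 'b) \<Rightarrow> ('a \<Rightarrow> 'a \<Rightarrow> 'b) \<Rightarrow> bool" where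
  "W13 \<Omega> M u Du \<longleftrightarrow>
     u \<in> borel_measurable (lebesgue_on \<Omega>) \<and>
     integrable (lebesgue_on \<Omega>) (\<lambda>x. norm (u x) ^ 3) \<and>
     (\<forall>x\<in>\<Omega>. linear (Du x)) \<and>
     (\<forall>v. (\<lambda>x. Du x v) \<in> borel_measurable (lebesgue_on \<Omega>) \<and>
          integrable (lebesgue_on \<Omega>) (\<lambda>x. norm (Du x v) ^ 3)) \<and>
     (\<forall>\<eta> v. test_function \<Omega> \<eta> \<longrightarrow>
        (LINT x|lebesgue_on \<Omega>. frechet_derivative \<eta> (at x) v *\<^sub>R u x) =
        - (LINT x|lebesgue_on \<Omega>. \<eta> x *\<^sub>R Du x v)) \<and>
     (AE x in lebesgue_on \<Omega>. u x \<in> M)"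

text \<open>Metrics on open subsets of Euclidean 3-space are given by their coefficient matrices.\<close>

definition metric_form :: "real^3^3 \<Rightarrow> real^3 \<Rightarrow> real^3 \<Rightarrow> real" where
  "metric_form G v w = v \<bullet> (G *v w)"

definition riemannian_metric :: "(real^3) set \<Rightarrow> (real^3 \<Rightarrow> real^3^3) \<Rightarrow> bool" where
  "riemannian_metric \<Omega> g \<longleftrightarrow> Ck_map \<infinity> \<Omega> g \<and>
     (\<forall>x\<in>\<Omega>. transpose (g x) = g x \<and> (\<forall>v. v \<noteq> 0 \<longrightarrow> 0 < metric_form (g x) v v))"

definition W13_smith_map ::
    "(real^3) set \<Rightarrow> (real^3 \<Rightarrow> real^3^3) \<Rightarrow> 'b::euclidean_space set \<Rightarrow> ('b \<Rightarrow> 'b \<Rightarrow> 'b \<Rightarrow> 'b) \<Rightarrow>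
     (real^3 \<Rightarrow> 'b) \<Rightarrow> (real^3 \<Rightarrow> real^3 \<Rightarrow> 'b) \<Rightarrow> bool" where
  "W13_smith_map \<Omega> g M J u Du \<longleftrightarrow> W13 \<Omega> M u Du \<and>
     (AE x in lebesgue_on \<Omega>.
        smith_equation UNIV (metric_form (g x)) standard_orientation (J (u x)) (Du x))"

text \<open>Suprema are taken in \<^typ>\<open>ennreal\<close> so that they are infinite for unbounded functions; the
  pointwise norms are the Euclidean ones of the coefficients \<open>g_ij\<close> and \<open>D_k g_ij\<close>.\<close>

definition C1_distance_to_euclidean :: "(real^3) set \<Rightarrow> (real^3 \<Rightarrow> real^3^3) \<Rightarrow> ennreal" where
  "C1_distance_to_euclidean A g =
     (SUP x\<in>A. ennreal (norm (g x - mat 1))) +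
     (SUP x\<in>A. ennreal (sqrt (\<Sum>k\<in>UNIV. (norm (frechet_derivative g (at x) (axis k 1)))\<^sup>2)))"

definition euclidean_energy :: "(real^3) set \<Rightarrow> (real^3 \<Rightarrow> real^3 \<Rightarrow> 'b::real_normed_vector) \<Rightarrow> ennreal" where
  "euclidean_energy A Du = (\<integral>\<^sup>+x. ennreal (hs_norm UNIV (\<bullet>) (Du x) ^ 3) \<partial>lebesgue_on A)"

definition energy_decay_pair ::
    "'b::euclidean_space set \<Rightarrow> ('b \<Rightarrow> 'b \<Rightarrow> 'b \<Rightarrow> 'b) \<Rightarrow> real \<Rightarrow> real \<Rightarrow> real \<Rightarrow> bool" where
  "energy_decay_pair M J \<alpha> \<epsilon> \<theta> \<longleftrightarrow> \<epsilon> \<in> {0<..<1/9} \<and> \<theta> \<in> {0<..<1/9} \<and>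
     (\<forall>g u Du. riemannian_metric (ball 0 2) g \<and>
        C1_distance_to_euclidean (ball 0 2) g \<le> ennreal \<epsilon> \<and>
        W13_smith_map (ball 0 2) g M J u Du \<and>
        euclidean_energy (ball 0 2) Du < ennreal \<epsilon> \<longrightarrow>
        euclidean_energy (ball 0 \<theta>) Du \<le> ennreal (\<theta> powr (3 * \<alpha>)) * euclidean_energy (ball 0 2) Du)"

end

theory Submission
  imports Defs
begin

text \<open>
  The Smith equation and the integral of \<open>|du|\<^sup>3\<close> on a 3-dimensional domain are conformally
  invariant.  Stereographic projection therefore turns \<open>u\<close> into a Smith map \<open>w\<close> on all of Euclidean
  3-space whose energy is at most that of \<open>u\<close>.  On Euclidean space there is a
  second family of conformal maps, the dilations.  The energy decay, applied with the flat metric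
  to \<open>x \<mapsto> w (r x)\<close>, reads \<open>E (\<theta> r) \<le> q E (2 r)\<close> for every radius \<open>r > 0\<close>, where \<open>E r\<close> is the energy
  of \<open>w\<close> on the ball of radius \<open>r\<close> and \<open>q = \<theta> powr (3 \<alpha>) < 1\<close>.  As all these balls have energy below
  the threshold, the estimate can be iterated outwards: \<open>E r \<le> q\<^sup>n E \<infinity>\<close> for all \<open>n\<close>, so the energy
  vanishes, \<open>w\<close> is constant, and \<open>u\<close> is constant by continuity at the pole.

  The pointwise conformal invariance is \<open>conformal_linear.smith_equation_pullback\<close>, and the comparison
  of energies is \<open>euclidean_energy_pullback_le\<close>.  The projection need not preserve the given
  orientation of the sphere, but by connectedness (\<open>orientation_along_immersion\<close>) it either preserves
  or reverses it everywhere; in the second case it is composed with \<open>x \<mapsto> -x\<close>, which reverses the orientation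
  of 3-space.  The decay hypothesis concerns Sobolev maps, so \<open>w\<close> must be shown to have its classical
  derivative as weak derivative (\<open>W13_of_C1\<close>).  The iteration is \<open>smith_map_R3_derivative_eq_0\<close>.
\<close>


section \<open>Conformal invariance of the Smith equation\<close>

lemma orthogonal_frame_rows:
  fixes A :: "real^3^3"
  assumes "\<And>i j. column i A \<bullet> column j A = (if i = j then 1 else 0)"
  shows "A ** transpose A = mat 1" "transpose A ** A = mat 1"
proof -
  show "transpose A ** A = mat 1"
    using assms by (simp add: vec_eq_iff matrix_matrix_mult_def transpose_def mat_def column_def inner_vec_def)
  then show "A ** transpose A = mat 1" by (simp add: matrix_left_right_inverse)
qed

text \<open>The rows of an orthogonal matrix are orthonormal too, so the mixed terms cancel when the
  squared norms of \<open>D\<close> on the columns are expanded in the standard basis.\<close>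

lemma sum_norm_square_orthonormal_columns:
  fixes D :: "real^3 \<Rightarrow> 'b::euclidean_space" and A :: "real^3^3"
  assumes D: "linear D" and A: "\<And>i j. column i A \<bullet> column j A = (if i = j then 1 else 0)"
  shows "(\<Sum>i\<in>UNIV. (norm (D (column i A)))\<^sup>2) = (\<Sum>i\<in>UNIV. (norm (D (axis i 1)))\<^sup>2)"
proof -
  have *: "(\<Sum>i\<in>UNIV. A$j$i * A$k$i) = (if j = k then 1 else 0)" for j k
    using orthogonal_frame_rows(1)[OF A]
    by (auto simp: vec_eq_iff matrix_matrix_mult_def transpose_def mat_def)
  have D': "D (column i A) = (\<Sum>j\<in>UNIV. A$j$i *\<^sub>R D (axis j 1))" for i
  proof -
    have "column i A = (\<Sum>j\<in>UNIV. A$j$i *\<^sub>R axis j 1)"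
      by (simp add: vec_eq_iff column_def axis_def if_distrib if_distribR cong: if_cong)
    then show ?thesis using D by (simp add: linear_sum linear_scale)
  qed
  have "(\<Sum>i\<in>UNIV. (norm (D (column i A)))\<^sup>2)
     = (\<Sum>i\<in>UNIV. \<Sum>j\<in>UNIV. \<Sum>k\<in>UNIV. (A$j$i * A$k$i) * (D (axis j 1) \<bullet> D (axis k 1)))"
    by (simp only: D' power2_norm_eq_inner inner_sum_left) (simp add: inner_sum_right mult.assoc mult.left_commute)
  also have "\<dots> = (\<Sum>j\<in>UNIV. \<Sum>k\<in>UNIV. \<Sum>i\<in>UNIV. (A$j$i * A$k$i) * (D (axis j 1) \<bullet> D (axis k 1)))"
    by (rule trans[OF sum.swap], rule sum.cong[OF refl], rule sum.swap)
  also have "\<dots> = (\<Sum>j\<in>UNIV. \<Sum>k\<in>UNIV. (if j = k then 1 else 0) * (D (axis j 1) \<bullet> D (axis k 1)))"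
    by (simp only: sum_distrib_right[symmetric] *)
  also have "\<dots> = (\<Sum>i\<in>UNIV. (norm (D (axis i 1)))\<^sup>2)"
    by (simp add: if_distrib if_distribR power2_norm_eq_inner cong: if_cong)
  finally show ?thesis .
qed

lemma standard_orientation_eq:
  "standard_orientation = {\<lambda>i. column i A | A :: real^3^3. 0 < det A}"
proof (intro set_eqI iffI; clarsimp simp: standard_orientation_def)
  fix e :: "3 \<Rightarrow> real^3" assume "0 < det (\<chi> i. e i)"
  then show "\<exists>A. e = (\<lambda>i. column i A) \<and> 0 < det A"
    by (intro exI[of _ "transpose (\<chi> i. e i)"] conjI, simp add: column_def transpose_def)
       (simp only: det_transpose)
next
  fix A :: "real^3^3" assume "0 < det A"
  moreover have "(\<chi> i. column i A) = transpose A" by (simp add: column_def transpose_def vec_eq_iff)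
  ultimately show "0 < det (\<chi> i. column i A)" by (simp add: det_transpose)
qed

text \<open>A linear conformal embedding of 3-space, such as the differential of a conformal
  parametrization. All pointwise notions of the Smith equation on its range are computed
  through it.\<close>

locale conformal_linear =
  fixes L :: "real^3 \<Rightarrow> 'a::euclidean_space" and \<kappa> :: real
  assumes linear: "linear L" and pos: "0 < \<kappa>"
    and inner: "L v \<bullet> L w = \<kappa>\<^sup>2 * (v \<bullet> w)"
begin

lemma inj: "inj L"
proof (rule linear_injective_0[OF linear, THEN iffD2], intro allI impI)
  fix x assume "L x = 0"
  then have "\<kappa>\<^sup>2 * (x \<bullet> x) = 0" using inner[of x x] by simp
  then show "x = 0" using pos by simp
qed

text \<open>In the coordinates given by \<open>L\<close>, an orthonormal frame of the range is an
  orthogonal matrix up to the factor \<open>\<kappa>\<close>.\<close>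

lemma orthonormal_frameE:
  assumes "orthonormal_frame (range L) (\<bullet>) e"
  obtains A where "\<And>i. e i = L (column i A)"
    "\<And>i j. column i (\<kappa> *\<^sub>R A) \<bullet> column j (\<kappa> *\<^sub>R A) = (if i = j then 1 else 0)"
proof -
  from assms have "\<forall>i. \<exists>a. e i = L a" unfolding orthonormal_frame_def by blast
  then obtain a where a: "\<And>i. e i = L (a i)" by metis
  define A :: "real^3^3" where "A = (\<chi> k i. a i $ k)"
  have c: "column i A = a i" for i by (simp add: A_def column_def vec_eq_iff)
  have cs: "column i (\<kappa> *\<^sub>R A) = \<kappa> *\<^sub>R a i" for i by (simp add: A_def column_def vec_eq_iff)
  show ?thesis
    by (rule that[of A])
       (use assms in \<open>auto simp: a c cs orthonormal_frame_def inner power2_eq_square mult.assoc\<close>)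
qed

lemma orthonormal_frame_axes: "orthonormal_frame (range L) (\<bullet>) (\<lambda>i. L (column i (mat (1/\<kappa>))))"
proof -
  have "column i (mat (1/\<kappa>)) = axis i (1/\<kappa>)" for i :: 3
    by (simp add: vec_eq_iff column_def mat_def axis_def)
  then show ?thesis using pos
    by (auto simp: orthonormal_frame_def inner inner_axis_axis power2_eq_square)
qed

text \<open>The description of the Hilbert--Schmidt norm denotes a number because the sum is the same for
  all orthonormal frames; it scales by \<open>1 / \<kappa>\<close> because \<open>L\<close>
  stretches the standard frame by \<open>\<kappa>\<close>.\<close>

lemma hs_norm_eq:
  fixes D :: "'a \<Rightarrow> 'b::euclidean_space"
  assumes D: "linear D"
  shows "hs_norm (range L) (\<bullet>) D = sqrt (\<Sum>i\<in>UNIV. (norm (D (L (axis i 1))))\<^sup>2) / \<kappa>"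
proof -
  have DL: "linear (\<lambda>x. D (L x))" using linear_compose[OF linear D] by (simp add: o_def)
  have *: "sqrt (\<Sum>i\<in>UNIV. (norm (D (e i)))\<^sup>2) = sqrt (\<Sum>i\<in>UNIV. (norm (D (L (axis i 1))))\<^sup>2) / \<kappa>"
    if "orthonormal_frame (range L) (\<bullet>) e" for e
  proof -
    obtain A where A: "\<And>i. e i = L (column i A)"
      "\<And>i j. column i (\<kappa> *\<^sub>R A) \<bullet> column j (\<kappa> *\<^sub>R A) = (if i = j then 1 else 0)"
      using orthonormal_frameE[OF \<open>orthonormal_frame (range L) (\<bullet>) e\<close>] by blast
    have "column i (\<kappa> *\<^sub>R A) = \<kappa> *\<^sub>R column i A" for i by (simp add: column_def vec_eq_iff)
    then have "\<kappa>\<^sup>2 * (\<Sum>i\<in>UNIV. (norm (D (e i)))\<^sup>2) = (\<Sum>i\<in>UNIV. (norm (D (L (axis i 1))))\<^sup>2)"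
      using sum_norm_square_orthonormal_columns[OF DL A(2)] pos
      by (simp add: A(1) linear_scale[OF DL] power_mult_distrib sum_distrib_left)
    then have "\<kappa> * sqrt (\<Sum>i\<in>UNIV. (norm (D (e i)))\<^sup>2) = sqrt (\<Sum>i\<in>UNIV. (norm (D (L (axis i 1))))\<^sup>2)"
      using pos by (metis abs_of_pos real_sqrt_abs real_sqrt_mult)
    then show ?thesis using pos by (simp add: field_simps)
  qed
  show ?thesis unfolding hs_norm_def
    by (rule the_equality) (use * orthonormal_frame_axes in metis)+
qed

text \<open>The volume form of the range pulls back to \<open>\<kappa>\<^sup>3 det\<close> and its inner
  product to \<open>\<kappa>\<^sup>2\<close> times the Euclidean one; the quotient of the two
  scales leaves one factor \<open>\<kappa>\<close> in front of the Euclidean Hodge star, which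
  is the cross product.\<close>

lemma hodge_star_eq:
  assumes P: "P = {\<lambda>i. L (column i A) | A :: real^3^3. 0 < det A}"
  shows "hodge_star (range L) (\<bullet>) P (L v) (L w) = \<kappa> *\<^sub>R L (cross3 v w)"
proof -
  let ?s = "\<kappa> *\<^sub>R L (cross3 v w)"
  have key: "?s \<bullet> z = det (\<chi> i j. (vector [L v, L w, z] :: 'a^3) $ i \<bullet> e j)"
    if e: "e \<in> P" "orthonormal_frame (range L) (\<bullet>) e" and "z \<in> range L" for e z
  proof -
    from \<open>z \<in> range L\<close> obtain z' where z: "z = L z'" by auto
    from e P obtain A where A: "e = (\<lambda>i. L (column i A))" and dA: "0 < det A" by auto
    obtain A' where A': "\<And>i. e i = L (column i A')"
        "\<And>i j. column i (\<kappa> *\<^sub>R A') \<bullet> column j (\<kappa> *\<^sub>R A') = (if i = j then 1 else 0)"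
      using orthonormal_frameE[OF e(2)] by blast
    have "column i A = column i A'" for i
      using A A'(1) inj by (metis injD)
    then have "A' = A" by (simp add: vec_eq_iff column_def)
    have s: "det (c *\<^sub>R B) = c^3 * det B" for c and B :: "real^3^3"
      by (simp add: det_3 power3_eq_cube algebra_simps)
    have "transpose (\<kappa> *\<^sub>R A) ** (\<kappa> *\<^sub>R A) = mat 1"
      using orthogonal_frame_rows(2)[OF A'(2)] \<open>A' = A\<close> by simp
    then have "(det (\<kappa> *\<^sub>R A))\<^sup>2 = 1"
      by (metis det_I det_mul det_transpose power2_eq_square)
    moreover have "0 < det (\<kappa> *\<^sub>R A)" using dA pos by (simp add: s)
    ultimately have d1: "\<kappa>^3 * det A = 1" by (simp add: s power2_eq_1_iff)
    define R :: "real^3^3" where "R = vector [v, w, z']"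
    have "(\<chi> i j. (vector [L v, L w, z] :: 'a^3) $ i \<bullet> e j) = \<kappa>\<^sup>2 *\<^sub>R (R ** A)"
      by (simp add: vec_eq_iff forall_3 A inner matrix_matrix_mult_def R_def z inner_vec_def column_def)
    then have "det (\<chi> i j. (vector [L v, L w, z] :: 'a^3) $ i \<bullet> e j) = \<kappa>^3 * det R * (\<kappa>^3 * det A)"
      by (simp add: s det_mul power_mult[symmetric])
    also have "\<dots> = \<kappa>^3 * det R" using d1 by simp
    also have "det R = cross3 v w \<bullet> z'"
      by (simp add: R_def cross3_def det_3 inner_vec_def sum_3 algebra_simps)
    finally show ?thesis
      by (simp add: z inner power2_eq_square power3_eq_cube)
  qed
  \<comment> \<open>Uniqueness of the star needs at least one positive orthonormal frame; \<open>E\<close> is the rescaled standard one.\<close>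
  define E where "E = (\<lambda>i. L (column i (mat (1/\<kappa>) :: real^3^3)))"
  have "det (mat (1/\<kappa>) :: real^3^3) > 0" using pos by (simp add: det_3 mat_def)
  then have E: "E \<in> P" "orthonormal_frame (range L) (\<bullet>) E"
    using orthonormal_frame_axes by (auto simp: P E_def)
  have sL: "?s \<in> range L" by (metis linear linear_scale rangeI)
  have "s = ?s" if s: "s \<in> range L" and
    eq: "\<forall>e\<in>P. orthonormal_frame (range L) (\<bullet>) e \<longrightarrow> (\<forall>z\<in>range L.
      s \<bullet> z = det (\<chi> i j. (vector [L v, L w, z] :: 'a^3) $ i \<bullet> e j))" for s
  proof -
    have "s - ?s \<in> range L"
      using linear_subspace_image[OF linear subspace_UNIV] s sL by (intro subspace_diff) auto
    then have "s \<bullet> (s - ?s) = ?s \<bullet> (s - ?s)" using eq key E by metis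
    then have "(s - ?s) \<bullet> (s - ?s) = 0" by (simp add: inner_diff_left)
    then show "s = ?s" by simp
  qed
  then show ?thesis
    unfolding hodge_star_def
  proof (intro the_equality)
    show "?s \<in> range L \<and> (\<forall>e\<in>P. orthonormal_frame (range L) (\<bullet>) e \<longrightarrow> (\<forall>z\<in>range L.
      ?s \<bullet> z = det (\<chi> i j. (vector [L v, L w, z] :: 'a^3) $ i \<bullet> e j)))"
      using sL key by blast
  qed blast
qed

end

interpretation conformal_linear_id: conformal_linear "\<lambda>x::real^3. x" 1
  by unfold_locales (auto simp: linear_id)

lemma hs_norm_euclidean:
  fixes D :: "real^3 \<Rightarrow> 'b::euclidean_space"
  assumes "linear D"
  shows "hs_norm UNIV (\<bullet>) D = sqrt (\<Sum>i\<in>UNIV. (norm (D (axis i 1)))\<^sup>2)"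
  using conformal_linear_id.hs_norm_eq[OF assms] by simp

context conformal_linear
begin

text \<open>The star on the range differs from the Euclidean one by a factor \<open>\<kappa>\<close>,
  which is exactly the ratio of the norm of the pullback to that of \<open>D\<close>; so the
  factors cancel.\<close>

lemma smith_equation_pullback:
  fixes D :: "'a \<Rightarrow> 'b::euclidean_space"
  assumes P: "P = {\<lambda>i. L (column i A) | A :: real^3^3. 0 < det A}"
    and D: "linear D" and smith: "smith_equation (range L) (\<bullet>) P B D"
  shows "smith_equation UNIV (\<bullet>) standard_orientation B (\<lambda>v. D (L v))"
proof -
  from conformal_linear_id.hodge_star_eq[where P = standard_orientation, OF standard_orientation_eq]
  have hodge: "hodge_star UNIV (\<bullet>) standard_orientation v w = cross3 v w" for v w by simp
  have DL: "linear (\<lambda>v. D (L v))" using linear_compose[OF linear D] by (simp add: o_def)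
  have hs: "hs_norm UNIV (\<bullet>) (\<lambda>v. D (L v)) = \<kappa> * hs_norm (range L) (\<bullet>) D"
    using hs_norm_euclidean[OF DL] hs_norm_eq[OF D] pos by simp
  show ?thesis unfolding smith_equation_def
  proof (intro ballI)
    fix v w
    have "B (D (L v)) (D (L w)) =
        (1 / sqrt 3 * hs_norm (range L) (\<bullet>) D) *\<^sub>R D (hodge_star (range L) (\<bullet>) P (L v) (L w))"
      using smith by (simp add: smith_equation_def)
    then show "B (D (L v)) (D (L w)) = (1 / sqrt 3 * hs_norm UNIV (\<bullet>) (\<lambda>v. D (L v))) *\<^sub>R
        D (L (hodge_star UNIV (\<bullet>) standard_orientation v w))"
      by (simp add: hodge_star_eq[OF P] hodge hs linear_scale[OF D])
  qed
qed

end


section \<open>Differentiability classes\<close>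

lemma frechet_derivative_apply:
  "(f has_derivative f') (at x) \<Longrightarrow> frechet_derivative f (at x) v = f' v"
  using frechet_derivative_at by metis

lemma Ck_open_cong:
  assumes "open U" "\<And>x. x \<in> U \<Longrightarrow> f x = g x" "Ck_open k U f"
  shows "Ck_open k U g"
  using assms
proof (induction k arbitrary: f g)
  case 0
  then show ?case using continuous_on_cong by fastforce
next
  case (Suc k)
  have d: "(g has_derivative frechet_derivative f (at x)) (at x)" if "x \<in> U" for x
    using Suc.prems that
    by (intro has_derivative_transform_within_open[of f _ x UNIV U g])
       (auto simp: frechet_derivative_works)
  then have eq: "frechet_derivative f (at x) v = frechet_derivative g (at x) v" if "x \<in> U" for x v
    using that frechet_derivative_apply by metis
  have "Ck_open k U (\<lambda>x. frechet_derivative g (at x) v)" for v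
    by (rule Suc.IH[OF \<open>open U\<close> eq]) (use Suc.prems in auto)
  moreover have "g differentiable at x" if "x \<in> U" for x
    using d[OF that] by (rule differentiableI)
  ultimately show ?case by simp
qed

text \<open>Builds a derivative family by hand, so that closure properties of \<open>C^k\<close> maps
  follow by induction from the usual derivative rules.\<close>

lemma Ck_open_SucI:
  assumes "open U" "\<And>x. x \<in> U \<Longrightarrow> (f has_derivative D x) (at x)" "\<And>v. Ck_open k U (\<lambda>x. D x v)"
  shows "Ck_open (Suc k) U f"
proof -
  have "Ck_open k U (\<lambda>x. frechet_derivative f (at x) v)" for v
    by (rule Ck_open_cong[OF assms(1) _ assms(3)[of v]]) (rule frechet_derivative_apply[OF assms(2), symmetric])
  moreover have "f differentiable at x" if "x \<in> U" for x
    using assms(2)[OF that] by (rule differentiableI)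
  ultimately show ?thesis by simp
qed

lemma Ck_open_SucD: "Ck_open (Suc k) U f \<Longrightarrow> Ck_open k U f"
  by (induction k arbitrary: f)
     (auto simp: differentiable_imp_continuous_within continuous_at_imp_continuous_on)

lemma Ck_open_has_derivative:
  "Ck_open (Suc k) U f \<Longrightarrow> x \<in> U \<Longrightarrow> (f has_derivative frechet_derivative f (at x)) (at x)"
  by (simp add: frechet_derivative_works)

lemma Ck_open_subset: "Ck_open k U f \<Longrightarrow> V \<subseteq> U \<Longrightarrow> Ck_open k V f"
  by (induction k arbitrary: f) (auto intro: continuous_on_subset)

lemma Ck_open_local:
  "(\<And>x. x \<in> U \<Longrightarrow> \<exists>V. open V \<and> x \<in> V \<and> Ck_open k V f) \<Longrightarrow> Ck_open k U f"
proof (induction k arbitrary: f)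
  case 0
  then show ?case
    by (auto intro!: continuous_at_imp_continuous_on simp: continuous_on_eq_continuous_at) 
       (metis continuous_on_eq_continuous_at)
next
  case (Suc k)
  then show ?case by (simp; meson)
qed

lemma Ck_open_const: "Ck_open k U (\<lambda>x. c)"
  by (induction k arbitrary: c) auto

lemma Ck_open_linear:
  assumes "bounded_linear f" shows "Ck_open k U f"
proof (cases k)
  case 0
  then show ?thesis using assms by (simp add: linear_continuous_on)
next
  case (Suc j)
  have d: "(f has_derivative f) (at x)" for x
    using assms by (rule bounded_linear_imp_has_derivative)
  then have "frechet_derivative f (at x) v = f v" for x v by (rule frechet_derivative_apply)
  moreover have "f differentiable at x" for x
    using d by (rule differentiableI)
  ultimately show ?thesis
    by (simp add: Suc Ck_open_const)
qed

lemma Ck_open_add: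
  assumes "open U" "Ck_open k U f" "Ck_open k U g" shows "Ck_open k U (\<lambda>x. f x + g x)"
  using assms(2,3)
proof (induction k arbitrary: f g)
  case 0
  then show ?case by (auto intro: continuous_intros)
next
  case (Suc k)
  show ?case
  proof (rule Ck_open_SucI[OF \<open>open U\<close>])
    show "((\<lambda>x. f x + g x) has_derivative
        (\<lambda>v. frechet_derivative f (at x) v + frechet_derivative g (at x) v)) (at x)"
      if "x \<in> U" for x
      using Suc.prems that by (intro has_derivative_add Ck_open_has_derivative)
    show "Ck_open k U (\<lambda>x. frechet_derivative f (at x) v + frechet_derivative g (at x) v)" for v
      using Suc.prems by (intro Suc.IH) auto
  qed
qed

lemma Ck_open_scaleR:
  fixes f :: "'a::euclidean_space \<Rightarrow> real"
  assumes "open U" "Ck_open k U f" "Ck_open k U g" shows "Ck_open k U (\<lambda>x. f x *\<^sub>R g x)"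
  using assms(2,3)
proof (induction k arbitrary: f g)
  case 0
  then show ?case by (auto intro: continuous_intros)
next
  case (Suc k)
  show ?case
  proof (rule Ck_open_SucI[OF \<open>open U\<close>])
    show "((\<lambda>x. f x *\<^sub>R g x) has_derivative
        (\<lambda>v. f x *\<^sub>R frechet_derivative g (at x) v + frechet_derivative f (at x) v *\<^sub>R g x)) (at x)"
      if "x \<in> U" for x
      using Suc.prems that by (intro has_derivative_scaleR Ck_open_has_derivative)
    show "Ck_open k U (\<lambda>x. f x *\<^sub>R frechet_derivative g (at x) v + frechet_derivative f (at x) v *\<^sub>R g x)"
      for v
      using Suc.prems Suc.prems[THEN Ck_open_SucD] by (intro Ck_open_add[OF \<open>open U\<close>] Suc.IH) auto
  qed
qed

lemma Ck_open_inverse: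
  fixes f :: "'a::euclidean_space \<Rightarrow> real"
  assumes "open U" "\<And>x. x \<in> U \<Longrightarrow> f x \<noteq> 0" "Ck_open k U f" shows "Ck_open k U (\<lambda>x. inverse (f x))"
  using assms(3)
proof (induction k)
  case 0
  then show ?case using assms(2) by (auto intro: continuous_intros)
next
  case (Suc k)
  show ?case
  proof (rule Ck_open_SucI[OF \<open>open U\<close>])
    show "((\<lambda>x. inverse (f x)) has_derivative
        (\<lambda>v. (-1) *\<^sub>R inverse (f x) *\<^sub>R frechet_derivative f (at x) v *\<^sub>R inverse (f x))) (at x)"
      if "x \<in> U" for x
      using Deriv.has_derivative_inverse[OF assms(2)[OF that] Ck_open_has_derivative[OF Suc.prems that]]
      by (simp add: mult.assoc)
    show "Ck_open k U (\<lambda>x. (-1) *\<^sub>R inverse (f x) *\<^sub>R frechet_derivative f (at x) v *\<^sub>R inverse (f x))"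
      for v
      using Suc.prems Suc.IH[OF Ck_open_SucD[OF Suc.prems]]
      by (intro Ck_open_scaleR[OF \<open>open U\<close>] Ck_open_const) auto
  qed
qed

lemma Ck_open_line:
  fixes f :: "'a::euclidean_space \<Rightarrow> 'b::real_normed_vector"
  shows "Ck_open k UNIV f \<Longrightarrow> Ck_open k UNIV (\<lambda>t::real. f (x + t *\<^sub>R v))"
proof (induction k arbitrary: f)
  case 0
  then show ?case by (auto intro!: continuous_intros elim: continuous_on_subset intro: continuous_on_compose2)
next
  case (Suc k)
  show ?case
  proof (rule Ck_open_SucI[OF open_UNIV])
    show "((\<lambda>t. f (x + t *\<^sub>R v)) has_derivative
       (\<lambda>s. frechet_derivative f (at (x + t *\<^sub>R v)) (s *\<^sub>R v))) (at t)" for t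
      by (rule has_derivative_compose[of "\<lambda>t. x + t *\<^sub>R v"])
         (use Ck_open_has_derivative[OF Suc.prems] in \<open>auto intro!: derivative_eq_intros\<close>)
    show "Ck_open k UNIV (\<lambda>t. frechet_derivative f (at (x + t *\<^sub>R v)) (s *\<^sub>R v))" for s :: real
      by (rule Suc.IH) (use Suc.prems in simp)
  qed
qed

text \<open>The definition of \<open>C^1\<close> only makes the derivative continuous for each fixed
  direction; expanding the direction in a basis lets it vary continuously as well.\<close>

lemma continuous_on_derivative_apply:
  fixes F :: "'a::euclidean_space \<Rightarrow> 'b::real_normed_vector"
  assumes F: "Ck_open (Suc 0) U F" and "continuous_on W g" "g ` W \<subseteq> U" "continuous_on W h"
  shows "continuous_on W (\<lambda>x. frechet_derivative F (at (g x)) (h x))"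
proof -
  have "frechet_derivative F (at (g x)) (h x) =
      (\<Sum>b\<in>Basis. (h x \<bullet> b) *\<^sub>R frechet_derivative F (at (g x)) b)" if "x \<in> W" for x
  proof -
    have "linear (frechet_derivative F (at (g x)))"
      using F assms(3) that by (intro linear_frechet_derivative) auto
    then show ?thesis
      using linear_sum[of "frechet_derivative F (at (g x))" "\<lambda>b. (h x \<bullet> b) *\<^sub>R b" Basis]
      by (simp add: linear_scale euclidean_representation)
  qed
  moreover have "continuous_on W (\<lambda>x. frechet_derivative F (at (g x)) b)" for b
    by (rule continuous_on_compose2[of U "\<lambda>y. frechet_derivative F (at y) b" W g]) (use assms in auto)
  then have "continuous_on W (\<lambda>x. \<Sum>b\<in>Basis. (h x \<bullet> b) *\<^sub>R frechet_derivative F (at (g x)) b)"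
    using assms(4) by (intro continuous_on_sum continuous_on_scaleR continuous_on_inner continuous_on_const)
  ultimately show ?thesis by simp
qed

lemma C1_compose:
  assumes "open W" "Ck_open (Suc 0) W g" "Ck_open (Suc 0) U F" "g ` W \<subseteq> U"
  shows "Ck_open (Suc 0) W (\<lambda>x. F (g x))"
proof (rule Ck_open_SucI[OF \<open>open W\<close>])
  show "((\<lambda>x. F (g x)) has_derivative
     (\<lambda>v. frechet_derivative F (at (g x)) (frechet_derivative g (at x) v))) (at x)" if "x \<in> W" for x
    by (rule has_derivative_compose[OF Ck_open_has_derivative[OF assms(2) that]
          Ck_open_has_derivative[OF assms(3)]]) (use assms(4) that in auto)
  show "Ck_open 0 W (\<lambda>x. frechet_derivative F (at (g x)) (frechet_derivative g (at x) v))" for v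
    unfolding Ck_open.simps
    by (rule continuous_on_derivative_apply[OF assms(3) _ assms(4)])
       (use assms(2) Ck_open_SucD[OF assms(2)] in auto)
qed

lemma Ck_map_1E:
  assumes "Ck_map k S u" "1 \<le> k" "p \<in> S"
  obtains U F where "open U" "p \<in> U" "Ck_open (Suc 0) U F" "\<And>x. x \<in> S \<inter> U \<Longrightarrow> F x = u x"
proof -
  obtain U F where "open U" "p \<in> U" "\<forall>j. enat j \<le> k \<longrightarrow> Ck_open j U F" "\<forall>x\<in>S \<inter> U. F x = u x"
    using assms unfolding Ck_map_def by blast
  moreover have "enat (Suc 0) \<le> k" using \<open>1 \<le> k\<close> by (simp add: one_enat_def)
  ultimately show ?thesis using that by blast
qed

lemma Ck_map_imp_continuous_on:
  assumes "Ck_map k S u" "1 \<le> k" shows "continuous_on S u"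
  unfolding continuous_on_eq_continuous_within
proof
  fix p assume "p \<in> S"
  then obtain U F where U: "open U" "p \<in> U" "Ck_open (Suc 0) U F" "\<And>x. x \<in> S \<inter> U \<Longrightarrow> F x = u x"
    using Ck_map_1E[OF assms] by blast
  from U have "F differentiable at p within S" by (simp add: differentiable_at_withinI)
  then have "continuous (at p within S) F" by (rule differentiable_imp_continuous_within)
  then show "continuous (at p within S) u"
    by (rule continuous_transform_within_openin[where S="S \<inter> U"])
       (use U \<open>p \<in> S\<close> in \<open>auto simp: openin_open_Int\<close>)
qed

text \<open>On a submanifold the derivative within \<open>S\<close> is determined only on tangent vectors.
  The chain rule along \<open>\<psi>\<close> evaluates it on such vectors only, so that the
  pulled back map has a genuine derivative.\<close>

lemma C1_pullback:
  assumes u: "Ck_map 1 S u" and \<psi>: "Ck_open (Suc 0) UNIV \<psi>" "range \<psi> \<subseteq> S"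
  shows "Ck_open (Suc 0) UNIV (\<lambda>x. u (\<psi> x))"
    and "linear (differential S u (\<psi> x))"
    and "frechet_derivative (\<lambda>x. u (\<psi> x)) (at x) v =
           differential S u (\<psi> x) (frechet_derivative \<psi> (at x) v)"
proof -
  have cont: "continuous_on UNIV \<psi>" using Ck_open_SucD[OF \<psi>(1)] by simp
  show "Ck_open (Suc 0) UNIV (\<lambda>x. u (\<psi> x))"
  proof (rule Ck_open_local)
    fix x
    have "\<psi> x \<in> S" using \<psi>(2) by auto
    then obtain U F where U: "open U" "\<psi> x \<in> U" "Ck_open (Suc 0) U F"
        "\<And>x. x \<in> S \<inter> U \<Longrightarrow> F x = u x"
      using Ck_map_1E[OF u order_refl] by blast
    have o: "open (\<psi> -` U)" using cont U(1) by (simp add: continuous_on_open_vimage)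
    have "Ck_open (Suc 0) (\<psi> -` U) (\<lambda>x. F (\<psi> x))"
      by (rule C1_compose[OF o Ck_open_subset[OF \<psi>(1)] U(3)]) auto
    then have "Ck_open (Suc 0) (\<psi> -` U) (\<lambda>x. u (\<psi> x))"
      by (rule Ck_open_cong[OF o, rotated]) (use U \<psi>(2) in auto)
    then show "\<exists>V. open V \<and> x \<in> V \<and> Ck_open (Suc 0) V (\<lambda>x. u (\<psi> x))"
      using o U by blast
  qed
  have "\<psi> x \<in> S" using \<psi>(2) by auto
  then obtain U F where U: "open U" "\<psi> x \<in> U" "Ck_open (Suc 0) U F"
      "\<And>x. x \<in> S \<inter> U \<Longrightarrow> F x = u x"
    using Ck_map_1E[OF u order_refl] by blast
  obtain d where d: "0 < d" "ball (\<psi> x) d \<subseteq> U" using U(1,2) open_contains_ball by blast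
  have "(F has_derivative frechet_derivative F (at (\<psi> x))) (at (\<psi> x) within S)"
    by (rule has_derivative_at_withinI[OF Ck_open_has_derivative[OF U(3,2)]])
  then have "(u has_derivative frechet_derivative F (at (\<psi> x))) (at (\<psi> x) within S)"
    by (rule has_derivative_transform_within[OF _ d(1) \<open>\<psi> x \<in> S\<close>])
       (use U(4) d(2) in \<open>auto simp: dist_commute subset_iff\<close>)
  then have u': "(u has_derivative differential S u (\<psi> x)) (at (\<psi> x) within S)"
    unfolding differential_def frechet_derivative_works[symmetric] differentiable_def by blast
  show "linear (differential S u (\<psi> x))"
    using u' has_derivative_linear by blast
  have "((\<lambda>x. u (\<psi> x)) has_derivative
      (\<lambda>v. differential S u (\<psi> x) (frechet_derivative \<psi> (at x) v))) (at x)"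
    by (rule has_derivative_in_compose[OF Ck_open_has_derivative[OF \<psi>(1)] has_derivative_subset[OF u']])
       (use \<psi>(2) in auto)
  then show "frechet_derivative (\<lambda>x. u (\<psi> x)) (at x) v =
           differential S u (\<psi> x) (frechet_derivative \<psi> (at x) v)"
    by (rule frechet_derivative_apply)
qed


section \<open>Stereographic projection\<close>

definition equator :: "real^3 \<Rightarrow> real^4" where
  "equator x = x$1 *\<^sub>R axis 1 1 + x$2 *\<^sub>R axis 2 1 + x$3 *\<^sub>R axis 3 1"

definition drop_height :: "real^4 \<Rightarrow> real^3" where
  "drop_height p = p$1 *\<^sub>R axis 1 1 + p$2 *\<^sub>R axis 2 1 + p$3 *\<^sub>R axis 3 1"

abbreviation pole :: "real^4" where "pole \<equiv> axis 4 1"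

definition conformal_factor :: "real^3 \<Rightarrow> real" where
  "conformal_factor x = 2 / (1 + x \<bullet> x)"

text \<open>The inverse of the stereographic projection from the pole, written as the inversion in the
  sphere of radius \<open>sqrt 2\<close> about the pole; this form makes conformality a short
  computation.\<close>

definition stereo :: "real^3 \<Rightarrow> real^4" where
  "stereo x = pole + conformal_factor x *\<^sub>R (equator x - pole)"

definition stereo_inv :: "real^4 \<Rightarrow> real^3" where
  "stereo_inv p = inverse (1 - p$4) *\<^sub>R drop_height p"

definition stereo_derivative :: "real^3 \<Rightarrow> real^3 \<Rightarrow> real^4" where
  "stereo_derivative x v = conformal_factor x *\<^sub>R equator v
     - ((conformal_factor x)\<^sup>2 * (x \<bullet> v)) *\<^sub>R (equator x - pole)"

lemma bounded_linear_equator: "bounded_linear equator"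
  unfolding equator_def[abs_def] linear_conv_bounded_linear[symmetric]
  by (rule linearI) (simp_all add: algebra_simps scaleR_add_left)

lemma bounded_linear_drop_height: "bounded_linear drop_height"
  unfolding drop_height_def[abs_def] linear_conv_bounded_linear[symmetric]
  by (rule linearI) (simp_all add: algebra_simps scaleR_add_left)

lemma equator_nth: "equator x $ 1 = x$1" "equator x $ 2 = x$2" "equator x $ 3 = x$3" "equator x $ 4 = 0"
  by (simp_all add: equator_def axis_def)

lemma pole_nth: "pole $ 1 = 0" "pole $ 2 = 0" "pole $ 3 = 0" "pole $ 4 = 1"
  by (simp_all add: axis_def)

lemma drop_height_nth: "drop_height p $ 1 = p$1" "drop_height p $ 2 = p$2" "drop_height p $ 3 = p$3"
  by (simp_all add: drop_height_def axis_def)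

lemma inner_equator: "equator v \<bullet> equator w = v \<bullet> w" "equator v \<bullet> pole = 0" "pole \<bullet> equator v = 0"
    "pole \<bullet> pole = 1"
  by (simp_all add: inner_vec_def sum_4 sum_3 equator_nth pole_nth)

lemma conformal_factor_pos: "0 < conformal_factor x"
  by (simp add: conformal_factor_def add_pos_nonneg)

lemma conformal_factor_eq: "conformal_factor x * (1 + x \<bullet> x) = 2"
proof -
  have "0 < 1 + x \<bullet> x" by (simp add: add_pos_nonneg)
  then show ?thesis by (metis conformal_factor_def less_irrefl nonzero_eq_divide_eq)
qed

lemma stereo_in_sphere: "stereo x \<in> sphere 0 1"
proof -
  define q where "q = conformal_factor x"
  have "stereo x \<bullet> stereo x = 1 - 2 * q + q * (q * (1 + x \<bullet> x))"
    by (simp add: stereo_def q_def[symmetric] inner_simps inner_equator algebra_simps)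
  also have "\<dots> = 1" using conformal_factor_eq[of x] by (simp add: q_def)
  finally show ?thesis by (simp add: norm_eq_1)
qed

lemma stereo_nth_4: "stereo x $ 4 = 1 - conformal_factor x"
  by (simp add: stereo_def equator_nth pole_nth)

lemma stereo_inv_stereo: "stereo_inv (stereo x) = x"
proof -
  have "drop_height (stereo x) = conformal_factor x *\<^sub>R x"
    by (simp add: vec_eq_iff forall_3 drop_height_nth stereo_def equator_nth pole_nth)
  then show ?thesis
    using conformal_factor_pos[of x] by (simp add: stereo_inv_def stereo_nth_4)
qed

lemma stereo_stereo_inv:
  assumes "p \<in> sphere 0 1" "p$4 \<noteq> 1"
  shows "stereo (stereo_inv p) = p"
proof -
  define h where "h = p$4"
  have h: "1 - h \<noteq> 0" using assms(2) by (simp add: h_def)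
  have "p \<bullet> p = 1" using assms(1) by (simp add: norm_eq_1)
  then have dd: "drop_height p \<bullet> drop_height p = (1 - h) * (1 + h)"
    by (simp add: inner_vec_def sum_4 sum_3 drop_height_nth h_def algebra_simps)
  have "stereo_inv p \<bullet> stereo_inv p = inverse (1 - h) * (inverse (1 - h) * (drop_height p \<bullet> drop_height p))"
    by (simp add: stereo_inv_def h_def)
  also have "\<dots> = (1 + h) / (1 - h)"
    unfolding dd using h by (simp add: divide_inverse)
  finally have "1 + stereo_inv p \<bullet> stereo_inv p = 2 / (1 - h)"
    using h by (simp add: divide_simps) (simp add: algebra_simps)
  then have "conformal_factor (stereo_inv p) = 1 - h"
    using h by (simp add: conformal_factor_def)
  moreover have "equator (stereo_inv p) = inverse (1 - h) *\<^sub>R (p - h *\<^sub>R pole)"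
    by (simp add: vec_eq_iff forall_4 equator_nth pole_nth stereo_inv_def drop_height_nth h_def)
  ultimately have "stereo (stereo_inv p)
      = pole + (1 - h) *\<^sub>R (inverse (1 - h) *\<^sub>R (p - h *\<^sub>R pole) - pole)"
    by (simp only: stereo_def)
  also have "\<dots> = pole + (p - h *\<^sub>R pole) - (1 - h) *\<^sub>R pole"
    using h by (simp add: scaleR_diff_right)
  also have "\<dots> = p" by (simp add: scaleR_diff_left)
  finally show ?thesis .
qed

lemma range_stereo: "range stereo = sphere 0 1 \<inter> {p. p$4 \<noteq> 1}"
proof -
  have "stereo x $ 4 \<noteq> 1" for x using conformal_factor_pos[of x] by (simp add: stereo_nth_4)
  then have "range stereo \<subseteq> sphere 0 1 \<inter> {p. p$4 \<noteq> 1}" using stereo_in_sphere by blast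
  moreover have "p \<in> range stereo" if "p \<in> sphere 0 1 \<inter> {p. p$4 \<noteq> 1}" for p
    using that by (intro range_eqI[of _ _ "stereo_inv p"]) (simp add: stereo_stereo_inv)
  ultimately show ?thesis by blast
qed

lemma inj_stereo: "inj stereo"
  by (metis injI stereo_inv_stereo)

lemma has_derivative_stereo: "(stereo has_derivative stereo_derivative x) (at x)"
proof -
  have *: "0 < 1 + x \<bullet> x" by (simp add: add_pos_nonneg)
  have "(conformal_factor has_derivative (\<lambda>v. - (conformal_factor x)\<^sup>2 * (x \<bullet> v))) (at x)"
    unfolding conformal_factor_def[abs_def]
    by (rule derivative_eq_intros refl | use * in force)+
       (auto simp: power2_eq_square inner_commute field_simps)
  then show ?thesis unfolding stereo_def[abs_def]
    by (auto intro!: derivative_eq_intros bounded_linear_imp_has_derivative bounded_linear_equator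
        simp: stereo_derivative_def)
qed

lemma frechet_derivative_stereo: "frechet_derivative stereo (at x) = stereo_derivative x"
  using frechet_derivative_at[OF has_derivative_stereo] by simp

text \<open>The identity rests on \<open>|equator x - pole|\<^sup>2 = 1 + |x|\<^sup>2\<close>, which is 2
  divided by the conformal factor: the two cross terms cancel the square of the radial term.\<close>

lemma conformal_stereo: "conformal_linear (stereo_derivative x) (conformal_factor x)"
proof (rule conformal_linear.intro)
  show "linear (stereo_derivative x)" using has_derivative_stereo by (rule has_derivative_linear)
  show "0 < conformal_factor x" by (rule conformal_factor_pos)
  fix v w
  define q where "q = conformal_factor x"
  have comm: "v \<bullet> x = x \<bullet> v" "w \<bullet> x = x \<bullet> w" by (rule inner_commute)+
  have "stereo_derivative x v \<bullet> stereo_derivative x w =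
      q\<^sup>2 * (v \<bullet> w) - 2 * q^3 * (x \<bullet> v) * (x \<bullet> w) + q^3 * (x \<bullet> v) * (x \<bullet> w) * (q * (1 + x \<bullet> x))"
    by (simp add: stereo_derivative_def q_def[symmetric] inner_simps inner_equator
         comm algebra_simps power2_eq_square power3_eq_cube)
  then show "stereo_derivative x v \<bullet> stereo_derivative x w = (conformal_factor x)\<^sup>2 * (v \<bullet> w)"
    using conformal_factor_eq[of x] by (simp add: q_def)
qed

lemma Ck_open_conformal_factor: "Ck_open k UNIV conformal_factor"
proof -
  have "Ck_open j UNIV (\<lambda>x::real^3. x \<bullet> x)" for j
  proof (cases j)
    case 0
    then show ?thesis by (auto intro: continuous_intros)
  next
    case (Suc i)
    have "((\<lambda>x. x \<bullet> x) has_derivative (\<lambda>v. (2 *\<^sub>R v) \<bullet> x)) (at x)" for x :: "real^3"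
      by (auto intro!: derivative_eq_intros simp: inner_commute)
    then show ?thesis unfolding Suc
      by (rule Ck_open_SucI[OF open_UNIV]) (rule Ck_open_linear[OF bounded_linear_inner_right])
  qed
  then have "Ck_open k UNIV (\<lambda>x::real^3. 2 *\<^sub>R inverse (1 + x \<bullet> x))"
    by (intro Ck_open_scaleR Ck_open_inverse Ck_open_add Ck_open_const open_UNIV)
       (metis add_pos_nonneg inner_ge_zero less_numeral_extra(1) less_numeral_extra(3))
  then show ?thesis
    by (simp add: conformal_factor_def[abs_def] divide_inverse)
qed

lemma Ck_open_stereo: "Ck_open k UNIV stereo"
proof -
  have "Ck_open k UNIV (\<lambda>x. pole + conformal_factor x *\<^sub>R (equator x + (- pole)))"
    by (intro Ck_open_add Ck_open_scaleR Ck_open_const Ck_open_conformal_factor Ck_open_linear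
         bounded_linear_equator open_UNIV)
  then show ?thesis by (simp add: stereo_def[abs_def])
qed

lemma continuous_on_height: "continuous_on S (\<lambda>p::real^4. p$4)"
  by (intro continuous_intros)

lemma open_off_pole: "open {p::real^4. p$4 \<noteq> 1}"
  by (intro open_Collect_neq continuous_on_height continuous_on_const)

lemma Ck_open_stereo_inv: "Ck_open k {p. p$4 \<noteq> 1} stereo_inv"
proof -
  have "Ck_open k {p. p$4 \<noteq> 1} (\<lambda>p::real^4. inverse (1 + (-1) *\<^sub>R p$4) *\<^sub>R drop_height p)"
    by (intro Ck_open_scaleR Ck_open_inverse Ck_open_add Ck_open_const Ck_open_linear open_off_pole
        bounded_linear_drop_height bounded_linear_vec_nth) auto
  then show ?thesis by (simp add: stereo_inv_def[abs_def])
qed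

lemma local_parametrization_stereo: "local_parametrization (sphere 0 1) UNIV stereo"
  unfolding local_parametrization_def
proof (intro conjI)
  show "openin (top_of_set (sphere 0 1)) (range stereo)"
    unfolding range_stereo using open_off_pole by (rule openin_open_Int)
  show "inj stereo" by (rule inj_stereo)
  show "Ck_map \<infinity> UNIV stereo"
    unfolding Ck_map_def using Ck_open_stereo by blast
  show "Ck_map \<infinity> (range stereo) (inv stereo)"
    unfolding Ck_map_def
  proof -
    have inv: "stereo_inv p = inv stereo p" if "p \<in> range stereo" for p
      using that by (auto simp: stereo_inv_stereo inj_stereo)
    show "\<forall>p\<in>range stereo. \<exists>U F. open U \<and> p \<in> U \<and> (\<forall>j. enat j \<le> \<infinity> \<longrightarrow> Ck_open j U F) \<and>
        (\<forall>x\<in>range stereo \<inter> U. F x = inv stereo x)"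
    by (intro ballI exI[of _ "{p. p$4 \<noteq> 1}"] exI[of _ stereo_inv])
       (use range_stereo in \<open>auto simp: open_off_pole Ck_open_stereo_inv inv simp del: sphere_def mem_sphere_0\<close>)
  qed
qed auto

text \<open>Curves in the sphere through \<open>stereo x\<close> stay off the pole for a short time, so
  that they factor through the parametrization and their velocities lie in the range of its
  differential. Conversely the images of straight lines realize every vector of the range.\<close>

lemma tangent_space_sphere: "tangent_space (sphere 0 1) (stereo x) = range (stereo_derivative x)"
proof (intro equalityI subsetI)
  fix w assume "w \<in> range (stereo_derivative x)"
  then obtain v where w: "w = stereo_derivative x v" by auto
  define \<gamma> where "\<gamma> = (\<lambda>t. stereo (x + t *\<^sub>R v))"
  have "(\<gamma> has_derivative (\<lambda>t. stereo_derivative x (t *\<^sub>R v))) (at 0)"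
    unfolding \<gamma>_def
    by (rule has_derivative_compose[of "\<lambda>t. x + t *\<^sub>R v"])
       (use has_derivative_stereo[of x] in \<open>auto intro!: derivative_eq_intros\<close>)
  then have "(\<gamma> has_vector_derivative w) (at 0)"
    by (simp add: has_vector_derivative_def w linear_scale conformal_linear.linear[OF conformal_stereo])
  moreover have "Ck_map \<infinity> {-1<..<1} \<gamma>"
    unfolding Ck_map_def \<gamma>_def using Ck_open_line[OF Ck_open_stereo] by blast
  moreover have "\<gamma> ` {-1<..<1} \<subseteq> sphere 0 1" "\<gamma> 0 = stereo x"
    unfolding \<gamma>_def using stereo_in_sphere by auto
  ultimately show "w \<in> tangent_space (sphere 0 1) (stereo x)"
    unfolding tangent_space_def by (auto intro!: exI[of _ \<gamma>] exI[of _ 1])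
next
  fix w assume "w \<in> tangent_space (sphere 0 1) (stereo x)"
  then obtain \<gamma> \<delta> where \<delta>: "0 < (\<delta>::real)" and S: "\<gamma> ` {-\<delta><..<\<delta>} \<subseteq> sphere 0 1" and \<gamma>0: "\<gamma> 0 = stereo x"
    and d: "(\<gamma> has_vector_derivative w) (at 0)"
    by (auto simp: tangent_space_def)
  define P where "P = frechet_derivative stereo_inv (at (stereo x))"
  have "stereo x \<in> {p. p$4 \<noteq> 1}" using range_stereo by blast
  then have P: "(stereo_inv has_derivative P) (at (\<gamma> 0))"
    unfolding P_def \<gamma>0 by (rule Ck_open_has_derivative[OF Ck_open_stereo_inv])
  have d': "(\<gamma> has_derivative (\<lambda>t. t *\<^sub>R w)) (at 0)" using d by (simp add: has_vector_derivative_def)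
  have "((\<lambda>t. stereo (stereo_inv (\<gamma> t))) has_derivative (\<lambda>t. stereo_derivative x (P (t *\<^sub>R w)))) (at 0)"
    by (rule has_derivative_compose[OF has_derivative_compose[OF d' P]])
       (simp add: \<gamma>0 stereo_inv_stereo has_derivative_stereo)
  moreover have "\<forall>\<^sub>F t in at 0. stereo (stereo_inv (\<gamma> t)) = \<gamma> t"
  proof -
    have "(\<gamma> \<longlongrightarrow> stereo x) (at 0)"
      using has_derivative_continuous[OF d'] by (simp add: continuous_within \<gamma>0)
    then have "\<forall>\<^sub>F t in at 0. \<gamma> t \<in> {p. p$4 \<noteq> 1}"
      using open_off_pole \<open>stereo x \<in> {p. p$4 \<noteq> 1}\<close> by (rule topological_tendstoD)
    moreover have "\<forall>\<^sub>F t in at 0. t \<in> {-\<delta><..<\<delta>}"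
      using \<delta> by (intro eventually_at_in_open') auto
    ultimately show ?thesis
      by eventually_elim (use S in \<open>auto intro!: stereo_stereo_inv\<close>)
  qed
  ultimately have "(\<gamma> has_derivative (\<lambda>t. stereo_derivative x (P (t *\<^sub>R w)))) (at 0)"
    by (rule has_derivative_transform_eventually) (simp_all add: \<gamma>0 stereo_inv_stereo)
  then have "(\<lambda>t. t *\<^sub>R w) = (\<lambda>t. stereo_derivative x (P (t *\<^sub>R w)))"
    using d' has_derivative_unique by blast
  then have "w = stereo_derivative x (P w)" by (metis scaleR_one)
  then show "w \<in> range (stereo_derivative x)" by (rule range_eqI)
qed

lemma volume_density_stereo:
  "sqrt (det (\<chi> i j. stereo_derivative x (axis i 1) \<bullet> stereo_derivative x (axis j 1))) = conformal_factor x ^ 3"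
proof -
  interpret conformal_linear "stereo_derivative x" "conformal_factor x" by (rule conformal_stereo)
  have "det (\<chi> i j. stereo_derivative x (axis i 1) \<bullet> stereo_derivative x (axis j 1))
      = (conformal_factor x ^ 3)\<^sup>2"
    by (simp add: det_3 inner inner_axis_axis power2_eq_square power3_eq_cube)
  then have "sqrt (det (\<chi> i j. stereo_derivative x (axis i 1) \<bullet> stereo_derivative x (axis j 1)))
      = \<bar>conformal_factor x ^ 3\<bar>" by (simp only: real_sqrt_abs)
  then show ?thesis using pos by simp
qed


section \<open>Orientations along an immersion\<close>

lemma matrix_mult_column:
  fixes H :: "real^3 \<Rightarrow> real^3"
  assumes "linear H"
  shows "H (column i A) = column i (matrix H ** A)"
proof -
  have "H (column i A) = matrix H *v column i A" using assms by (simp add: matrix_works)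
  also have "\<dots> = column i (matrix H ** A)"
    by (simp add: vec_eq_iff matrix_vector_mult_def matrix_matrix_mult_def column_def)
  finally show ?thesis .
qed

text \<open>How the frames carried by \<open>P\<close> with positive matrix look after the change of
  coordinates \<open>H\<close>: their matrices are multiplied by that of \<open>H\<close>.\<close>

lemma pushed_frames_change:
  fixes H :: "real^3 \<Rightarrow> real^3" and P :: "real^3 \<Rightarrow> 'a"
  assumes H: "linear H" "det (matrix H) \<noteq> 0"
  shows "{\<lambda>i. P (column i A) | A :: real^3^3. 0 < det A} =
    {\<lambda>i. P (H (column i A)) | A :: real^3^3. 0 < det (matrix H) * det A}"
proof (intro equalityI subsetI; clarsimp)
  fix A :: "real^3^3" assume A: "0 < det A"
  obtain B where B: "matrix H ** B = mat 1"
    using H(2) by (metis invertible_det_nz invertible_right_inverse)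
  have "matrix H ** (B ** A) = A" by (simp add: matrix_mul_assoc B matrix_mul_lid)
  moreover from this have "det (matrix H) * det (B ** A) = det A" by (metis det_mul)
  ultimately show "\<exists>C. (\<lambda>i. P (column i A)) = (\<lambda>i. P (H (column i C))) \<and> 0 < det (matrix H) * det C"
    using A by (intro exI[of _ "B ** A"]) (simp add: matrix_mult_column[OF H(1)])
next
  fix A :: "real^3^3" assume "0 < det (matrix H) * det A"
  then show "\<exists>C. (\<lambda>i. P (H (column i A))) = (\<lambda>i. P (column i C)) \<and> 0 < det C"
    by (intro exI[of _ "matrix H ** A"]) (simp add: matrix_mult_column[OF H(1)] det_mul)
qed

text \<open>The orientation is positive for some parametrization \<open>\<phi>\<close> near the point, and
  \<open>\<psi>\<close> differs from \<open>\<phi>\<close> by the transition map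
  \<open>\<phi>\<inverse> \<circ> \<psi>\<close>. Its differential \<open>H\<close> is
  invertible and continuous, and the sign of its determinant decides whether
  \<open>\<psi>\<close> preserves the orientation.\<close>

lemma orientation_locally:
  fixes S :: "'a::euclidean_space set" and \<psi> :: "real^3 \<Rightarrow> 'a"
  assumes ori: "orientation S ori" and \<psi>: "Ck_open (Suc 0) UNIV \<psi>" "range \<psi> \<subseteq> S"
    and inj: "\<And>x. inj (frechet_derivative \<psi> (at x))"
  obtains W and H :: "real^3 \<Rightarrow> real^3 \<Rightarrow> real^3" where "open W" "x0 \<in> W" "continuous_on W (\<lambda>x. det (matrix (H x)))"
    "\<forall>x\<in>W. det (matrix (H x)) \<noteq> 0 \<and>
      ori (\<psi> x) = {\<lambda>i. frechet_derivative \<psi> (at x) (column i A) | A :: real^3^3. 0 < det (matrix (H x)) * det A}"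
proof -
  have "\<psi> x0 \<in> S" using \<psi>(2) by auto
  then obtain V \<phi> where loc: "local_parametrization S V \<phi>" and x0: "\<psi> x0 \<in> \<phi> ` V"
    and ori\<phi>: "\<And>y. y \<in> V \<Longrightarrow> ori (\<phi> y) =
        {\<lambda>i. frechet_derivative \<phi> (at y) (column i A) | A :: real^3^3. 0 < det A}"
    using ori unfolding orientation_def by meson
  have one: "(1::enat) \<le> \<infinity>" by simp
  have V: "open V" "openin (top_of_set S) (\<phi> ` V)" "inj_on \<phi> V"
    and \<phi>: "Ck_map \<infinity> V \<phi>" and inv: "Ck_map \<infinity> (\<phi> ` V) (inv_into V \<phi>)"
    using loc by (auto simp: local_parametrization_def)
  obtain Q where Q: "open Q" "\<phi> ` V = S \<inter> Q" using V(2) by (auto simp: openin_open)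
  obtain U F where U: "open U" "\<psi> x0 \<in> U" "Ck_open (Suc 0) U F"
      "\<And>p. p \<in> \<phi> ` V \<inter> U \<Longrightarrow> F p = inv_into V \<phi> p"
    using Ck_map_1E[OF inv one x0] by blast
  \<comment> \<open>On \<open>W\<close> the transition map is \<open>F \<circ> \<psi>\<close>, where \<open>F\<close> extends the inverse of \<open>\<phi>\<close> smoothly.\<close>
  define W where "W = \<psi> -` (Q \<inter> U)"
  define H where "H x v = frechet_derivative F (at (\<psi> x)) (frechet_derivative \<psi> (at x) v)" for x v
  have cont: "continuous_on UNIV \<psi>" using Ck_open_SucD[OF \<psi>(1)] by simp
  have W: "open W" "x0 \<in> W"
    using continuous_open_preimage[OF cont open_UNIV open_Int[OF Q(1) U(1)]] Q U(2) x0
    by (auto simp: W_def)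
  have img: "\<psi> x \<in> \<phi> ` V" "\<psi> x \<in> U" if "x \<in> W" for x
    using that \<psi>(2) Q(2) by (auto simp: W_def)
  have F\<psi>: "F (\<psi> x) \<in> V" "\<phi> (F (\<psi> x)) = \<psi> x" if "x \<in> W" for x
    using img[OF that] U(4)[of "\<psi> x"] by (auto simp: inv_into_into f_inv_into_f)
  have dH: "((\<lambda>x. F (\<psi> x)) has_derivative H x) (at x)" if "x \<in> W" for x
    unfolding H_def
    by (rule has_derivative_compose[OF Ck_open_has_derivative[OF \<psi>(1)]
        Ck_open_has_derivative[OF U(3) img(2)[OF that]]]) simp
  have linH: "linear (H x)" if "x \<in> W" for x using dH[OF that] by (rule has_derivative_linear)
  have chain: "frechet_derivative \<psi> (at x) v = frechet_derivative \<phi> (at (F (\<psi> x))) (H x v)"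
    if xW: "x \<in> W" for x v
  proof -
    obtain U' G where G: "open U'" "F (\<psi> x) \<in> U'" "Ck_open (Suc 0) U' G" "\<And>y. y \<in> V \<inter> U' \<Longrightarrow> G y = \<phi> y"
      using Ck_map_1E[OF \<phi> one F\<psi>(1)[OF xW]] by blast
    have "(\<phi> has_derivative frechet_derivative G (at (F (\<psi> x)))) (at (F (\<psi> x)))"
      by (rule has_derivative_transform_within_open[OF Ck_open_has_derivative[OF G(3,2)]
            open_Int[OF V(1) G(1)]])
         (use F\<psi>(1)[OF that] G in auto)
    then have "(\<phi> has_derivative frechet_derivative \<phi> (at (F (\<psi> x)))) (at (F (\<psi> x)))"
      using frechet_derivative_at by metis
    from has_derivative_compose[OF dH[OF that] this]
    have "(\<psi> has_derivative (\<lambda>v. frechet_derivative \<phi> (at (F (\<psi> x))) (H x v))) (at x)"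
      by (rule has_derivative_transform_within_open[OF _ W(1) that]) (rule F\<psi>(2))
    then show ?thesis by (rule frechet_derivative_apply)
  qed
  have det: "det (matrix (H x)) \<noteq> 0" if "x \<in> W" for x
  proof -
    have "inj (H x)"
      using inj[of x] unfolding inj_def chain[OF that] by metis
    then show ?thesis
      using linH[OF that]
      by (metis det_nz_iff_inj matrix_vector_mul_linear matrix_works inj_def)
  qed
  show ?thesis
  proof (rule that[OF W, of H])
    have "continuous_on W (\<lambda>x. H x v)" for v
      unfolding H_def
    proof (rule continuous_on_derivative_apply[OF U(3)])
      show "continuous_on W \<psi>" using cont continuous_on_subset by blast
      show "continuous_on W (\<lambda>x. frechet_derivative \<psi> (at x) v)"
        using \<psi>(1) by (auto intro: continuous_on_subset)
      show "\<psi> ` W \<subseteq> U" using img by auto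
    qed
    then show "continuous_on W (\<lambda>x. det (matrix (H x)))"
      by (simp add: det_3 matrix_def) (intro continuous_intros)
    show "\<forall>x\<in>W. det (matrix (H x)) \<noteq> 0 \<and> ori (\<psi> x) =
      {\<lambda>i. frechet_derivative \<psi> (at x) (column i A) | A :: real^3^3. 0 < det (matrix (H x)) * det A}"
    proof
      fix x assume "x \<in> W"
      show "det (matrix (H x)) \<noteq> 0 \<and> ori (\<psi> x) =
        {\<lambda>i. frechet_derivative \<psi> (at x) (column i A) | A :: real^3^3. 0 < det (matrix (H x)) * det A}"
      using det[OF \<open>x \<in> W\<close>] ori\<phi>[OF F\<psi>(1)[OF \<open>x \<in> W\<close>]]
        pushed_frames_change[OF linH[OF \<open>x \<in> W\<close>] det[OF \<open>x \<in> W\<close>], of "frechet_derivative \<phi> (at (F (\<psi> x)))"]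
      by (simp only: F\<psi>(2)[OF \<open>x \<in> W\<close>] chain[OF \<open>x \<in> W\<close>]) simp
    qed
  qed
qed

text \<open>The points at which \<open>\<psi>\<close> preserves the orientation and those at which it
  reverses it form two disjoint open sets covering 3-space, which is connected.\<close>

lemma orientation_along_immersion:
  fixes S :: "'a::euclidean_space set" and \<psi> :: "real^3 \<Rightarrow> 'a"
  assumes ori: "orientation S ori" and \<psi>: "Ck_open (Suc 0) UNIV \<psi>" "range \<psi> \<subseteq> S"
    and inj: "\<And>x. inj (frechet_derivative \<psi> (at x))"
  obtains s :: real where "s = 1 \<or> s = - 1"
    "\<forall>x. ori (\<psi> x) = {\<lambda>i. frechet_derivative \<psi> (at x) (column i A) | A :: real^3^3. 0 < s * det A}"
proof -
  define fr where "fr s x = {\<lambda>i. frechet_derivative \<psi> (at x) (column i A) | A :: real^3^3. 0 < s * det A}"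
    for s :: real and x
  have loc: "\<exists>W s. open W \<and> x \<in> W \<and> (s = 1 \<or> s = -1) \<and> (\<forall>y\<in>W. ori (\<psi> y) = fr s y)" for x
  proof -
    obtain W and H :: "real^3 \<Rightarrow> real^3 \<Rightarrow> real^3"
      where W: "open W" "x \<in> W" and cont: "continuous_on W (\<lambda>x. det (matrix (H x)))"
      and H': "\<forall>x\<in>W. det (matrix (H x)) \<noteq> 0 \<and> ori (\<psi> x) = fr (det (matrix (H x))) x"
      unfolding fr_def by (rule orientation_locally[OF ori \<psi> inj, of x])
    from H' have H: "det (matrix (H x)) \<noteq> 0 \<and> ori (\<psi> x) = fr (det (matrix (H x))) x" if "x \<in> W" for x
      using that by blast
    define s where "s = sgn (det (matrix (H x)))"
    have s: "s = 1 \<or> s = -1" using H[OF W(2)] by (auto simp: s_def sgn_if)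
    define W' where "W' = {y\<in>W. 0 < s * det (matrix (H y))}"
    have "continuous_on W (\<lambda>y. s * det (matrix (H y)))"
      using cont by (intro continuous_on_mult continuous_on_const)
    then have "open (W \<inter> (\<lambda>y. s * det (matrix (H y))) -` {0<..})"
      using W(1) by (rule continuous_open_preimage) simp
    moreover have "W' = W \<inter> (\<lambda>y. s * det (matrix (H y))) -` {0<..}" by (auto simp: W'_def)
    ultimately have "open W'" by simp
    moreover have "x \<in> W'"
      using W(2) H[OF W(2)] by (auto simp: W'_def s_def sgn_if)
    moreover have "ori (\<psi> y) = fr s y" if "y \<in> W'" for y
    proof -
      have "0 < det (matrix (H y)) * det A \<longleftrightarrow> 0 < s * det A" for A :: "real^3^3"
        using that s by (auto simp: W'_def zero_less_mult_iff)
      then show ?thesis using H that by (simp add: fr_def W'_def)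
    qed
    ultimately show ?thesis using s by blast
  qed
  \<comment> \<open>Disjointness: a frame determines its matrix because the derivative is injective.\<close>
  have disj: "fr 1 x \<noteq> fr (-1) x" for x
  proof
    assume "fr 1 x = fr (-1) x"
    moreover have "(\<lambda>i. frechet_derivative \<psi> (at x) (column i (mat 1))) \<in> fr 1 x"
      unfolding fr_def by (auto intro!: exI[of _ "mat 1"])
    ultimately have "(\<lambda>i. frechet_derivative \<psi> (at x) (column i (mat 1))) \<in> fr (-1) x" by simp
    then obtain B :: "real^3^3" where eq: "(\<lambda>i. frechet_derivative \<psi> (at x) (column i (mat 1))) =
        (\<lambda>i. frechet_derivative \<psi> (at x) (column i B))" and B: "det B < 0"
      unfolding fr_def by auto
    from fun_cong[OF eq] have "frechet_derivative \<psi> (at x) (column i (mat 1)) =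
        frechet_derivative \<psi> (at x) (column i B)" for i by simp
    then have "column i (mat 1) = column i B" for i using inj by (metis injD)
    then have "mat 1 = B" by (simp add: vec_eq_iff column_def)
    then show False using B by auto
  qed
  have "open {x. ori (\<psi> x) = fr s x}" if "s = 1 \<or> s = -1" for s
  proof (subst open_subopen, intro ballI)
    fix x assume "x \<in> {x. ori (\<psi> x) = fr s x}"
    then have x: "ori (\<psi> x) = fr s x" by simp
    from loc[of x] obtain W s' where W: "open W" "x \<in> W" and s': "s' = 1 \<or> s' = -1"
      and eq: "\<forall>y\<in>W. ori (\<psi> y) = fr s' y"
      by (elim exE conjE) (rule that)
    have "fr s x = fr s' x" using eq W(2) x by simp
    then have "s' = s" using disj[of x] that s' by metis
    then have "W \<subseteq> {x. ori (\<psi> x) = fr s x}" using eq by auto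
    then show "\<exists>T. open T \<and> x \<in> T \<and> T \<subseteq> {x. ori (\<psi> x) = fr s x}"
      using W by (intro exI[of _ W] conjI)
  qed
  then have "open {x. ori (\<psi> x) = fr 1 x}" "open {x. ori (\<psi> x) = fr (-1) x}" by auto
  moreover have "{x. ori (\<psi> x) = fr 1 x} \<inter> {x. ori (\<psi> x) = fr (-1) x} \<inter> UNIV = {}"
    using disj by auto
  moreover have cover: "ori (\<psi> x) = fr 1 x \<or> ori (\<psi> x) = fr (-1) x" for x
    using loc[of x] by (elim exE conjE disjE) simp_all
  ultimately have "{x. ori (\<psi> x) = fr 1 x} \<inter> UNIV = {} \<or> {x. ori (\<psi> x) = fr (-1) x} \<inter> UNIV = {}"
    by (intro connectedD[OF connected_UNIV]) auto
  then have "(\<forall>x. ori (\<psi> x) = fr 1 x) \<or> (\<forall>x. ori (\<psi> x) = fr (-1) x)"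
    using cover by auto
  then show ?thesis
  proof
    assume "\<forall>x. ori (\<psi> x) = fr 1 x"
    then show ?thesis by (intro that[of 1]) (simp_all add: fr_def)
  next
    assume "\<forall>x. ori (\<psi> x) = fr (-1) x"
    then show ?thesis by (intro that[of "-1"]) (simp_all add: fr_def)
  qed
qed


section \<open>Volume on the sphere in stereographic coordinates\<close>

lemma stereo_inv_measurable: "stereo_inv \<in> borel_measurable borel"
proof -
  have "(\<lambda>p::real^4. p$4) \<in> borel_measurable borel"
    by (intro borel_measurable_continuous_onI continuous_on_height)
  moreover have "drop_height \<in> borel_measurable borel"
    by (intro borel_measurable_continuous_onI linear_continuous_on bounded_linear_drop_height)
  ultimately show ?thesis
    unfolding stereo_inv_def[abs_def] by measurable
qed

text \<open>The volume measure restricted to the sphere without the pole is transported by the projection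
  to the measure with density the cube of the conformal factor. Dropping the pole can only
  decrease the integral.\<close>

lemma energy_stereo_le:
  fixes f :: "real^4 \<Rightarrow> ennreal"
  assumes \<mu>: "volume_measure3 (sphere 0 1) \<mu>" and f: "(\<lambda>x. f (stereo x)) \<in> borel_measurable borel"
  shows "(\<integral>\<^sup>+x. ennreal (conformal_factor x ^ 3) * f (stereo x) \<partial>lborel) \<le> (\<integral>\<^sup>+x. f x \<partial>\<mu>)"
proof -
  have sets: "sets \<mu> = sets (restrict_space borel (sphere 0 1))"
    using \<mu> by (simp add: volume_measure3_def)
  have vol: "emeasure \<mu> (stereo ` A) = (\<integral>\<^sup>+x\<in>A. ennreal (conformal_factor x ^ 3) \<partial>lborel)"
    if A: "A \<in> sets borel" for A
  proof -
    have "local_parametrization (sphere 0 1) UNIV stereo \<and> A \<in> sets borel \<and> A \<subseteq> UNIV"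
      using A local_parametrization_stereo by simp
    then have "emeasure \<mu> (stereo ` A) = (\<integral>\<^sup>+x\<in>A. ennreal (sqrt (det (\<chi> i j.
        frechet_derivative stereo (at x) (axis i 1) \<bullet> frechet_derivative stereo (at x) (axis j 1)))) \<partial>lborel)"
      using \<mu> unfolding volume_measure3_def by blast
    then show ?thesis by (simp only: frechet_derivative_stereo volume_density_stereo)
  qed
  have space: "space \<mu> = sphere 0 1"
    using sets_eq_imp_space_eq[OF sets] by (simp add: space_restrict_space)
  have "range stereo \<in> sets (restrict_space borel (sphere 0 1))"
    unfolding range_stereo using open_off_pole
    by (simp add: sets_restrict_space_iff)
  then have R: "range stereo \<in> sets \<mu>" using sets by simp
  have "(\<lambda>x. conformal_factor x ^ 3) \<in> borel_measurable borel"
    using Ck_open_conformal_factor[of 0] by (intro borel_measurable_continuous_onI continuous_on_power) simp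
  then have cf: "(\<lambda>x. ennreal (conformal_factor x ^ 3)) \<in> borel_measurable lborel"
    by simp
  define N where "N = restrict_space \<mu> (range stereo)"
  have "stereo_inv \<in> measurable \<mu> borel"
    unfolding measurable_cong_sets[OF sets refl]
    by (rule measurable_restrict_space1[OF stereo_inv_measurable])
  then have inv: "stereo_inv \<in> measurable N borel"
    unfolding N_def by (rule measurable_restrict_space1)
  have eq: "distr N borel stereo_inv = density lborel (\<lambda>x. ennreal (conformal_factor x ^ 3))"
  proof (rule measure_eqI)
    fix A assume "A \<in> sets (distr N borel stereo_inv)"
    then have A: "A \<in> sets borel" by simp
    have pre: "stereo_inv -` A \<inter> space N = stereo ` A"
      using R sets.sets_into_space by (fastforce simp: N_def space_restrict_space stereo_inv_stereo)
    have "emeasure (distr N borel stereo_inv) A = emeasure N (stereo ` A)"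
      using emeasure_distr[OF inv A] pre by simp
    also have "\<dots> = emeasure \<mu> (stereo ` A)"
      unfolding N_def using R by (intro emeasure_restrict_space) auto
    finally show "emeasure (distr N borel stereo_inv) A =
        emeasure (density lborel (\<lambda>x. ennreal (conformal_factor x ^ 3))) A"
      using vol[OF A] A emeasure_density[OF cf] by simp
  qed simp
  have "(\<integral>\<^sup>+x. ennreal (conformal_factor x ^ 3) * f (stereo x) \<partial>lborel)
      = (\<integral>\<^sup>+x. f (stereo x) \<partial>density lborel (\<lambda>x. ennreal (conformal_factor x ^ 3)))"
    using cf f by (intro nn_integral_density[symmetric]) auto
  also have "\<dots> = (\<integral>\<^sup>+p. f (stereo (stereo_inv p)) \<partial>N)"
    unfolding eq[symmetric] by (rule nn_integral_distr[OF inv]) (use f in simp)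
  also have "\<dots> = (\<integral>\<^sup>+p. f p \<partial>N)"
    by (intro nn_integral_cong) (auto simp: N_def space_restrict_space stereo_inv_stereo)
  also have "\<dots> = (\<integral>\<^sup>+p. f p * indicator (range stereo) p \<partial>\<mu>)"
    unfolding N_def using R by (intro nn_integral_restrict_space) auto
  also have "\<dots> \<le> (\<integral>\<^sup>+p. f p \<partial>\<mu>)"
    by (intro nn_integral_mono) (auto split: split_indicator)
  finally show ?thesis .
qed


section \<open>Continuously differentiable maps as Sobolev maps\<close>

lemma continuous_on_compact_integrable_lebesgue:
  fixes f :: "'a::euclidean_space \<Rightarrow> 'b::euclidean_space"
  assumes "continuous_on UNIV f" "\<Omega> \<in> sets borel" "bounded \<Omega>"
  shows "integrable (lebesgue_on \<Omega>) f"
proof -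
  obtain r where r: "\<Omega> \<subseteq> cball 0 r"
    using \<open>bounded \<Omega>\<close> by (auto simp: bounded_iff subset_iff)
  have "integrable lborel (\<lambda>x. indicator (cball 0 r) x *\<^sub>R f x)"
    using assms(1) by (intro borel_integrable_compact) (auto intro: continuous_on_subset)
  then have "integrable lborel (\<lambda>x. indicator \<Omega> x *\<^sub>R f x)"
  proof (rule Bochner_Integration.integrable_bound)
    show "(\<lambda>x. indicator \<Omega> x *\<^sub>R f x) \<in> borel_measurable lborel"
      using assms(2) borel_measurable_continuous_onI[OF assms(1)] by measurable
    show "AE x in lborel. norm (indicator \<Omega> x *\<^sub>R f x) \<le> norm (indicator (cball 0 r) x *\<^sub>R f x)"
      using r by (intro AE_I2) (auto simp: indicator_def)
  qed
  then have "integrable lebesgue (\<lambda>x. indicator \<Omega> x *\<^sub>R f x)"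
    by (subst integrable_completion) auto
  then show ?thesis
    using assms(2) by (subst integrable_restrict_space) auto
qed

text \<open>The difference quotients of \<open>f\<close> in direction \<open>v\<close> have integral 0 by
  translation invariance of the Lebesgue measure. They are bounded by the supremum of the
  derivative and supported in a fixed ball, so the integrals converge to that of the
  derivative.\<close>

lemma integral_directional_derivative_eq_0:
  fixes f :: "'a::euclidean_space \<Rightarrow> 'b::euclidean_space"
  assumes f: "Ck_open (Suc 0) UNIV f" and K: "compact K" "\<And>x. x \<notin> K \<Longrightarrow> f x = 0"
  shows "(LINT x|lborel. frechet_derivative f (at x) v) = 0"
proof -
  let ?D = "\<lambda>x. frechet_derivative f (at x) v"
  have cf: "continuous_on UNIV f" using Ck_open_SucD[OF f] by simp
  have cD: "continuous_on UNIV ?D" using f by simp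
  obtain r where r: "K \<subseteq> cball 0 r" "0 < r"
    using compact_imp_bounded[OF K(1)] by (auto simp: bounded_pos subset_iff)
  have D0: "?D x = 0" if "x \<notin> K" for x
  proof -
    have "(f has_derivative (\<lambda>_. 0)) (at x)"
      by (rule has_derivative_transform_within_open[of "\<lambda>_. 0" _ _ _ "- K"])
         (use that K compact_imp_closed in auto)
    then show ?thesis by (rule frechet_derivative_apply)
  qed
  have "compact (?D ` K)" using cD K(1) by (intro compact_continuous_image) (auto intro: continuous_on_subset)
  then obtain B where B: "\<And>x. x \<in> K \<Longrightarrow> norm (?D x) \<le> B"
    using compact_imp_bounded bounded_iff by (metis (no_types, lifting) imageI)
  \<comment> \<open>\<open>K\<close> may be empty, in which case \<open>B\<close> can be negative.\<close>
  define C where "C = max B 0"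
  have C: "norm (?D x) \<le> C" for x using B[of x] D0[of x] by (cases "x \<in> K") (auto simp: C_def)
  have line: "norm (f (x + t *\<^sub>R v) - f x) \<le> C * t" if "0 < t" for x t
  proof -
    have "norm (f (x + t *\<^sub>R v) - f (x + 0 *\<^sub>R v)) \<le> C * norm (t - 0)"
    proof (rule differentiable_bound[where S=UNIV and f="\<lambda>s. f (x + s *\<^sub>R v)"
          and f'="\<lambda>s h. h *\<^sub>R ?D (x + s *\<^sub>R v)"])
      fix s :: real
      have d: "(f has_derivative frechet_derivative f (at (x + s *\<^sub>R v))) (at (x + s *\<^sub>R v))"
        by (rule Ck_open_has_derivative[OF f]) simp
      have "((\<lambda>s. f (x + s *\<^sub>R v)) has_derivative (\<lambda>h. frechet_derivative f (at (x + s *\<^sub>R v)) (h *\<^sub>R v))) (at s)"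
        by (rule has_derivative_compose[of "\<lambda>s. x + s *\<^sub>R v", OF _ d]) (auto intro!: derivative_eq_intros)
      then show "((\<lambda>s. f (x + s *\<^sub>R v)) has_derivative (\<lambda>h. h *\<^sub>R ?D (x + s *\<^sub>R v))) (at s)"
        by (simp add: linear_scale[OF has_derivative_linear[OF d]])
      show "onorm (\<lambda>h::real. h *\<^sub>R ?D (x + s *\<^sub>R v)) \<le> C"
        using C by (intro onorm_le) (simp add: mult_left_mono mult.commute[of C])
    qed auto
    then show ?thesis using that by simp
  qed
  have int_f: "integrable lborel f"
  proof -
    have "integrable lborel (\<lambda>x. indicator K x *\<^sub>R f x)"
      using cf K(1) by (intro borel_integrable_compact) (auto intro: continuous_on_subset)
    moreover have "indicator K x *\<^sub>R f x = f x" for x using K(2) by (auto split: split_indicator)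
    ultimately show ?thesis by simp
  qed
  have shift: "integrable lborel (\<lambda>x. f (x + w)) \<and> (LINT x|lborel. f (x + w)) = (LINT x|lborel. f x)" for w
  proof -
    have m: "(+) w \<in> lborel \<rightarrow>\<^sub>M borel" by simp
    have fb: "f \<in> borel_measurable borel" using cf by (rule borel_measurable_continuous_onI)
    have "integrable (distr lborel borel ((+) w)) f" using int_f by (simp add: lborel_distr_plus)
    then have 1: "integrable lborel (\<lambda>x. f (w + x))" by (rule integrable_distr[OF m])
    have 2: "(LINT x|lborel. f (w + x)) = (LINT x|distr lborel borel ((+) w). f x)"
      by (rule integral_distr[OF m fb, symmetric])
    from 1 2 show ?thesis by (simp add: lborel_distr_plus add.commute)
  qed
  define s where "s n x = real (Suc n) *\<^sub>R (f (x + (1 / real (Suc n)) *\<^sub>R v) - f x)" for n x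
  have s0: "(LINT x|lborel. s n x) = 0" for n
    unfolding s_def using shift int_f by simp
  have "(\<lambda>n. LINT x|lborel. s n x) \<longlonglongrightarrow> (LINT x|lborel. ?D x)"
  proof (rule integral_dominated_convergence[where w="\<lambda>x. indicator (cball 0 (r + norm v)) x * C"])
    show "?D \<in> borel_measurable lborel" using cD by (simp add: borel_measurable_continuous_onI)
    show "s n \<in> borel_measurable lborel" for n
      unfolding s_def using shift int_f by (intro borel_measurable_integrable) simp
    show "integrable lborel (\<lambda>x. indicator (cball (0::'a) (r + norm v)) x * C)"
    proof -
      have "integrable lborel (\<lambda>x. indicator (cball (0::'a) (r + norm v)) x *\<^sub>R C)"
        by (rule borel_integrable_compact) (rule compact_cball continuous_on_const)+
      then show ?thesis unfolding real_scaleR_def .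
    qed
    show "AE x in lborel. (\<lambda>n. s n x) \<longlonglongrightarrow> ?D x"
    proof (intro AE_I2)
      fix x
      have d: "(f has_derivative frechet_derivative f (at x)) (at x)"
        by (rule Ck_open_has_derivative[OF f]) simp
      have "((\<lambda>t. f (x + t *\<^sub>R v)) has_derivative (\<lambda>h. frechet_derivative f (at x) (h *\<^sub>R v))) (at 0)"
        by (rule has_derivative_compose[of "\<lambda>s. x + s *\<^sub>R v"]) (use d in \<open>auto intro!: derivative_eq_intros\<close>)
      then have "(\<lambda>h. norm (f (x + h *\<^sub>R v) - f x - h *\<^sub>R ?D x) / norm h) \<midarrow>0\<rightarrow> 0"
        unfolding has_derivative_at by (simp add: linear_scale[OF has_derivative_linear[OF d]])
      moreover have "filterlim (\<lambda>n. 1 / real (Suc n)) (at 0) sequentially"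
        unfolding filterlim_at using LIMSEQ_Suc[OF lim_1_over_n] by auto
      ultimately have "(\<lambda>n. norm (f (x + (1 / real (Suc n)) *\<^sub>R v) - f x - (1 / real (Suc n)) *\<^sub>R ?D x)
          / norm (1 / real (Suc n))) \<longlonglongrightarrow> 0"
        by (rule filterlim_compose)
      moreover have "norm (s n x - ?D x) = norm (f (x + (1 / real (Suc n)) *\<^sub>R v) - f x - (1 / real (Suc n)) *\<^sub>R ?D x)
          / norm (1 / real (Suc n))" for n
      proof -
        have "s n x - ?D x = real (Suc n) *\<^sub>R
            (f (x + (1 / real (Suc n)) *\<^sub>R v) - f x - (1 / real (Suc n)) *\<^sub>R ?D x)"
          unfolding s_def by (subst (2) scaleR_diff_right) simp
        then show ?thesis by (simp only: norm_scaleR) simp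
      qed
      ultimately have "(\<lambda>n. norm (s n x - ?D x)) \<longlonglongrightarrow> 0" by simp
      then show "(\<lambda>n. s n x) \<longlonglongrightarrow> ?D x"
        by (rule LIM_zero_cancel[OF tendsto_norm_zero_cancel])
    qed
    show "AE x in lborel. norm (s n x) \<le> indicator (cball 0 (r + norm v)) x * C" for n
    proof (intro AE_I2)
      fix x
      have n1: "norm ((1 / real (Suc n)) *\<^sub>R v) \<le> norm v"
        by (simp add: divide_simps) (simp add: algebra_simps)
      show "norm (s n x) \<le> indicator (cball 0 (r + norm v)) x * C"
      proof (cases "x \<in> cball 0 (r + norm v)")
        case True
        have "norm (s n x) = real (Suc n) * norm (f (x + (1 / real (Suc n)) *\<^sub>R v) - f x)"
          unfolding s_def norm_scaleR by simp
        also have "\<dots> \<le> real (Suc n) * (C * (1 / real (Suc n)))"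
          by (intro mult_left_mono line) auto
        also have "\<dots> = C" by simp
        finally show ?thesis using True by simp
      next
        case False
        then have "r + norm v < norm x" by simp
        moreover have "norm x \<le> norm (x + (1 / real (Suc n)) *\<^sub>R v) + norm ((1 / real (Suc n)) *\<^sub>R v)"
          using norm_triangle_ineq4[of "x + (1 / real (Suc n)) *\<^sub>R v" "(1 / real (Suc n)) *\<^sub>R v"] by simp
        ultimately have "r < norm (x + (1 / real (Suc n)) *\<^sub>R v)" "r < norm x"
          using n1 norm_ge_zero[of v] by linarith+
        then have "x + (1 / real (Suc n)) *\<^sub>R v \<notin> K" "x \<notin> K"
          using r(1) unfolding subset_iff mem_cball_0 by (metis not_le)+
        then show ?thesis using K(2) False by (simp add: s_def)
      qed
    qed
  qed
  then show ?thesis by (simp add: s0 LIMSEQ_const_iff)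
qed

text \<open>The integration by parts formula is the vanishing of the integral of the derivative of
  \<open>\<eta> w\<close>, which has compact support.\<close>

lemma W13_of_C1:
  fixes w :: "'a::euclidean_space \<Rightarrow> 'b::euclidean_space"
  assumes w: "Ck_open (Suc 0) UNIV w" and M: "range w \<subseteq> M" and \<Omega>: "open \<Omega>" "bounded \<Omega>"
  shows "W13 \<Omega> M w (\<lambda>x. frechet_derivative w (at x))"
proof -
  have cw: "continuous_on UNIV w" using Ck_open_SucD[OF w] by simp
  have cD: "continuous_on UNIV (\<lambda>x. frechet_derivative w (at x) v)" for v using w by simp
  have b: "\<Omega> \<in> sets borel" using \<Omega> by simp
  note int = continuous_on_compact_integrable_lebesgue[OF _ b \<Omega>(2)]
  have parts: "(LINT x|lebesgue_on \<Omega>. frechet_derivative \<eta> (at x) v *\<^sub>R w x) =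
        - (LINT x|lebesgue_on \<Omega>. \<eta> x *\<^sub>R frechet_derivative w (at x) v)"
    if test: "test_function \<Omega> \<eta>" for \<eta> v
  proof -
    obtain K where K: "compact K" "K \<subseteq> \<Omega>" "\<And>x. x \<notin> K \<Longrightarrow> \<eta> x = 0" and "Ck_map \<infinity> UNIV \<eta>"
      using test by (auto simp: test_function_def)
    have one: "(1::enat) \<le> \<infinity>" by simp
    have \<eta>: "Ck_open (Suc 0) UNIV \<eta>"
    proof (rule Ck_open_local)
      fix x :: 'a
      obtain U F where U: "open U" "x \<in> U" "Ck_open (Suc 0) U F" "\<And>y. y \<in> UNIV \<inter> U \<Longrightarrow> F y = \<eta> y"
        using Ck_map_1E[OF \<open>Ck_map \<infinity> UNIV \<eta>\<close> one UNIV_I] by blast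
      then have "Ck_open (Suc 0) U \<eta>" by (intro Ck_open_cong[OF U(1) _ U(3)]) auto
      then show "\<exists>V. open V \<and> x \<in> V \<and> Ck_open (Suc 0) V \<eta>" using U by blast
    qed
    have c\<eta>: "continuous_on UNIV \<eta>" using Ck_open_SucD[OF \<eta>] by simp
    have cD\<eta>: "continuous_on UNIV (\<lambda>x. frechet_derivative \<eta> (at x) v)" using \<eta> by simp
    let ?f = "\<lambda>x. \<eta> x *\<^sub>R w x"
    have f: "Ck_open (Suc 0) UNIV ?f" by (rule Ck_open_scaleR[OF open_UNIV \<eta> w])
    have f0: "?f x = 0" if "x \<notin> K" for x using K(3)[OF that] by simp
    have Df: "frechet_derivative ?f (at x) v =
        \<eta> x *\<^sub>R frechet_derivative w (at x) v + frechet_derivative \<eta> (at x) v *\<^sub>R w x" for x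
      by (rule frechet_derivative_apply, rule has_derivative_scaleR;
          rule Ck_open_has_derivative[OF _ UNIV_I], rule \<eta> w)
    have D0: "frechet_derivative ?f (at x) v = 0" if "x \<notin> K" for x
    proof -
      have "(?f has_derivative (\<lambda>_. 0)) (at x)"
        by (rule has_derivative_transform_within_open[of "\<lambda>_. 0" _ _ _ "- K"])
           (use that K compact_imp_closed in auto)
      then show ?thesis by (rule frechet_derivative_apply)
    qed
    have "(LINT x|lebesgue_on \<Omega>. frechet_derivative ?f (at x) v)
        = (LINT x|lebesgue. indicator \<Omega> x *\<^sub>R frechet_derivative ?f (at x) v)"
      using b by (subst integral_restrict_space) auto
    also have "\<dots> = (LINT x|lebesgue. frechet_derivative ?f (at x) v)"
      using D0 K(2) by (intro Bochner_Integration.integral_cong) (auto split: split_indicator)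
    also have "\<dots> = (LINT x|lborel. frechet_derivative ?f (at x) v)"
      using f by (intro integral_completion) (simp add: borel_measurable_continuous_onI)
    also have "\<dots> = 0" by (rule integral_directional_derivative_eq_0[OF f K(1) f0])
    finally have "(LINT x|lebesgue_on \<Omega>. \<eta> x *\<^sub>R frechet_derivative w (at x) v
        + frechet_derivative \<eta> (at x) v *\<^sub>R w x) = 0" by (simp only: Df)
    moreover have "integrable (lebesgue_on \<Omega>) (\<lambda>x. \<eta> x *\<^sub>R frechet_derivative w (at x) v)"
      "integrable (lebesgue_on \<Omega>) (\<lambda>x. frechet_derivative \<eta> (at x) v *\<^sub>R w x)"
      using c\<eta> cD\<eta> cw cD by (auto intro!: int continuous_on_scaleR)
    ultimately show ?thesis by (simp add: add_eq_0_iff)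
  qed
  have "AE x in lebesgue_on \<Omega>. w x \<in> M" using M by (intro AE_I2) auto
  moreover have "linear (frechet_derivative w (at x))" for x
    using w by (intro linear_frechet_derivative) simp
  moreover have "w \<in> borel_measurable (lebesgue_on \<Omega>)"
      "(\<lambda>x. frechet_derivative w (at x) v) \<in> borel_measurable (lebesgue_on \<Omega>)" for v
    using int[OF cw] int[OF cD] by (auto intro: borel_measurable_integrable)
  moreover have "integrable (lebesgue_on \<Omega>) (\<lambda>x. norm (w x) ^ 3)"
     "integrable (lebesgue_on \<Omega>) (\<lambda>x. norm (frechet_derivative w (at x) v) ^ 3)" for v
    using cw cD by (auto intro!: int continuous_on_power continuous_on_norm)
  ultimately show ?thesis unfolding W13_def using parts by blast
qed


section \<open>Euclidean energy and dilations\<close>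

abbreviation energy_density :: "(real^3 \<Rightarrow> 'b::euclidean_space) \<Rightarrow> real^3 \<Rightarrow> real" where
  "energy_density w x \<equiv> hs_norm UNIV (\<bullet>) (frechet_derivative w (at x)) ^ 3"

lemma energy_density_eq:
  assumes "Ck_open (Suc 0) UNIV w"
  shows "energy_density w x = sqrt (\<Sum>i\<in>UNIV. (norm (frechet_derivative w (at x) (axis i 1)))\<^sup>2) ^ 3"
  using assms by (subst hs_norm_euclidean) (auto intro: linear_frechet_derivative)

lemma continuous_on_energy_density:
  assumes "Ck_open (Suc 0) UNIV w"
  shows "continuous_on UNIV (energy_density w)"
proof -
  have "continuous_on UNIV (\<lambda>x. frechet_derivative w (at x) v)" for v using assms by simp
  then show ?thesis
    unfolding energy_density_eq[OF assms]
    by (intro continuous_on_power continuous_on_real_sqrt continuous_on_sum continuous_on_norm)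
qed

lemma energy_density_measurable:
  assumes "Ck_open (Suc 0) UNIV w"
  shows "(\<lambda>x. ennreal (energy_density w x)) \<in> borel_measurable borel"
  by (intro measurable_compose[OF _ measurable_ennreal] borel_measurable_continuous_onI
      continuous_on_energy_density assms)

lemma euclidean_energy_eq:
  assumes w: "Ck_open (Suc 0) UNIV w" and \<Omega>: "\<Omega> \<in> sets borel"
  shows "euclidean_energy \<Omega> (\<lambda>x. frechet_derivative w (at x))
    = (\<integral>\<^sup>+x. ennreal (energy_density w x) * indicator \<Omega> x \<partial>lborel)"
proof -
  have "euclidean_energy \<Omega> (\<lambda>x. frechet_derivative w (at x))
    = (\<integral>\<^sup>+x. ennreal (energy_density w x) * indicator \<Omega> x \<partial>lebesgue)"
    unfolding euclidean_energy_def using \<Omega> by (intro nn_integral_restrict_space) auto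
  then show ?thesis by (simp add: nn_integral_completion)
qed

lemma frechet_derivative_scale:
  assumes w: "Ck_open (Suc 0) UNIV w"
  shows "frechet_derivative (\<lambda>x. w (c *\<^sub>R x)) (at x) = (\<lambda>v. frechet_derivative w (at (c *\<^sub>R x)) (c *\<^sub>R v))"
proof -
  have "((\<lambda>x. w (c *\<^sub>R x)) has_derivative (\<lambda>v. frechet_derivative w (at (c *\<^sub>R x)) (c *\<^sub>R v))) (at x)"
    by (rule has_derivative_compose[OF _ Ck_open_has_derivative[OF w UNIV_I]])
       (auto intro!: derivative_eq_intros)
  then show ?thesis by (rule frechet_derivative_at[symmetric])
qed

lemma C1_scale:
  assumes "Ck_open (Suc 0) UNIV w"
  shows "Ck_open (Suc 0) UNIV (\<lambda>x. w (c *\<^sub>R x))"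
  by (rule C1_compose[OF open_UNIV Ck_open_linear[OF bounded_linear_scaleR_right] assms]) simp

text \<open>The cube of the norm of the differential scales like the volume element: the exponent 3 is the
  dimension of the domain.\<close>

lemma euclidean_energy_scale:
  fixes w :: "real^3 \<Rightarrow> 'b::euclidean_space"
  assumes w: "Ck_open (Suc 0) UNIV w" and c: "c \<noteq> 0" and \<Omega>: "\<Omega> \<in> sets borel"
  shows "euclidean_energy ((\<lambda>x. c *\<^sub>R x) -` \<Omega>) (\<lambda>x. frechet_derivative (\<lambda>x. w (c *\<^sub>R x)) (at x))
    = euclidean_energy \<Omega> (\<lambda>x. frechet_derivative w (at x))"
proof -
  let ?T = "\<lambda>x::real^3. 0 + c *\<^sub>R x"
  let ?h = "\<lambda>y. ennreal (energy_density w y) * indicator \<Omega> y"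
  have T: "?T \<in> borel \<rightarrow>\<^sub>M borel" by simp
  have h: "?h \<in> borel_measurable borel"
    using energy_density_measurable[OF w] \<Omega> by (intro borel_measurable_times_ennreal) auto
  have T\<Omega>: "(\<lambda>x. c *\<^sub>R x) -` \<Omega> \<in> sets borel"
    using measurable_sets[OF T, of \<Omega>] \<Omega> by simp
  have density: "energy_density (\<lambda>x. w (c *\<^sub>R x)) x = \<bar>c\<bar>^3 * energy_density w (c *\<^sub>R x)" for x
  proof -
    have lin: "linear (frechet_derivative w (at (c *\<^sub>R x)))"
      using w by (intro linear_frechet_derivative) simp
    have "(\<Sum>i\<in>UNIV. (norm (frechet_derivative w (at (c *\<^sub>R x)) (c *\<^sub>R axis i 1)))\<^sup>2)
        = c\<^sup>2 * (\<Sum>i\<in>UNIV. (norm (frechet_derivative w (at (c *\<^sub>R x)) (axis i 1)))\<^sup>2)"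
      by (simp add: linear_scale[OF lin] power_mult_distrib sum_distrib_left)
    then show ?thesis
      unfolding energy_density_eq[OF w] energy_density_eq[OF C1_scale[OF w]]
      unfolding frechet_derivative_scale[OF w]
      by (simp add: real_sqrt_mult power_mult_distrib)
  qed
  have "euclidean_energy \<Omega> (\<lambda>x. frechet_derivative w (at x)) = (\<integral>\<^sup>+y. ?h y \<partial>lborel)"
    by (rule euclidean_energy_eq[OF w \<Omega>])
  also have "\<dots> = (\<integral>\<^sup>+y. ?h y \<partial>density (distr lborel borel ?T) (\<lambda>_. ennreal (\<bar>c\<bar>^3)))"
    using lborel_affine[OF c, of "0::real^3"] by simp
  also have "\<dots> = (\<integral>\<^sup>+y. ennreal (\<bar>c\<bar>^3) * ?h y \<partial>distr lborel borel ?T)"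
    using h by (intro nn_integral_density) auto
  also have "\<dots> = (\<integral>\<^sup>+x. ennreal (\<bar>c\<bar>^3) * ?h (?T x) \<partial>lborel)"
    using h by (intro nn_integral_distr) auto
  also have "\<dots> = (\<integral>\<^sup>+x. ennreal (energy_density (\<lambda>x. w (c *\<^sub>R x)) x)
      * indicator ((\<lambda>x. c *\<^sub>R x) -` \<Omega>) x \<partial>lborel)"
    by (intro nn_integral_cong)
       (simp add: density ennreal_mult' indicator_def)
  also have "\<dots> = euclidean_energy ((\<lambda>x. c *\<^sub>R x) -` \<Omega>) (\<lambda>x. frechet_derivative (\<lambda>x. w (c *\<^sub>R x)) (at x))"
    by (rule euclidean_energy_eq[OF C1_scale[OF w] T\<Omega>, symmetric])
  finally show ?thesis by simp
qed


section \<open>Smith maps of small energy on Euclidean space\<close>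

lemma smith_equation_scale:
  fixes D :: "real^3 \<Rightarrow> 'b::euclidean_space"
  assumes c: "0 < c" and D: "linear D" and "smith_equation UNIV (\<bullet>) standard_orientation B D"
  shows "smith_equation UNIV (\<bullet>) standard_orientation B (\<lambda>v. D (c *\<^sub>R v))"
proof -
  let ?H = "\<lambda>v::real^3. c *\<^sub>R v"
  interpret conformal_linear ?H c
    using c by unfold_locales (auto simp: linear_iff algebra_simps power2_eq_square)
  have d: "0 < det (matrix ?H)"
    using c by (simp add: det_3 matrix_def axis_def)
  have "standard_orientation = {\<lambda>i. ?H (column i A) | A :: real^3^3. 0 < det A}"
    using pushed_frames_change[OF linear, of "\<lambda>v. v"] d
    by (simp add: standard_orientation_eq zero_less_mult_iff)
  moreover have "range ?H = UNIV"
    using c by (metis surjI pth_1 scaleR_scaleR right_inverse less_irrefl)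
  ultimately show ?thesis using smith_equation_pullback[OF _ D] assms(3) by simp
qed

text \<open>The flat metric is the only one to which the energy decay is applied; its distance to the
  Euclidean metric is 0.\<close>

lemma flat_metric:
  "metric_form (mat 1) = (\<bullet>)"
  "riemannian_metric \<Omega> (\<lambda>_. mat 1)"
  "\<Omega> \<noteq> {} \<Longrightarrow> C1_distance_to_euclidean \<Omega> (\<lambda>_. mat 1) = 0"
proof -
  show m: "metric_form (mat 1) = (\<bullet>)" by (simp add: metric_form_def fun_eq_iff)
  have "Ck_map \<infinity> \<Omega> (\<lambda>_. mat 1 :: real^3^3)"
    unfolding Ck_map_def
    by (intro ballI exI[of _ UNIV] exI[of _ "\<lambda>_. mat 1"]) (simp add: Ck_open_const)
  then show "riemannian_metric \<Omega> (\<lambda>_. mat 1)"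
    by (simp add: riemannian_metric_def m transpose_mat)
  show "C1_distance_to_euclidean \<Omega> (\<lambda>_. mat 1) = 0" if "\<Omega> \<noteq> {}"
    using that by (simp add: C1_distance_to_euclidean_def)
qed

text \<open>The decay estimate at radius \<open>r\<close> is the one on the ball of radius 2 for the
  dilated map \<open>x \<mapsto> w (r x)\<close>, which is again a Smith map with the same
  total energy.\<close>

lemma smith_map_R3_energy_decay:
  fixes w :: "real^3 \<Rightarrow> 'b::euclidean_space"
  assumes decay: "energy_decay_pair M J \<alpha> \<epsilon> \<theta>"
    and w: "Ck_open (Suc 0) UNIV w" "range w \<subseteq> M"
    and smith: "\<And>x. smith_equation UNIV (\<bullet>) standard_orientation (J (w x)) (frechet_derivative w (at x))"
    and small: "euclidean_energy UNIV (\<lambda>x. frechet_derivative w (at x)) < ennreal \<epsilon>"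
    and r: "0 < r"
  shows "euclidean_energy (ball 0 (\<theta> * r)) (\<lambda>x. frechet_derivative w (at x))
     \<le> ennreal (\<theta> powr (3 * \<alpha>)) * euclidean_energy (ball 0 (2 * r)) (\<lambda>x. frechet_derivative w (at x))"
proof -
  let ?w = "\<lambda>x. w (r *\<^sub>R x)"
  have pre: "(\<lambda>x::real^3. r *\<^sub>R x) -` ball 0 (s * r) = ball 0 s" for s
    using r by (auto simp: mult.commute[of s])
  have scale: "euclidean_energy (ball 0 s) (\<lambda>x. frechet_derivative ?w (at x))
      = euclidean_energy (ball 0 (s * r)) (\<lambda>x. frechet_derivative w (at x))" for s
    using euclidean_energy_scale[OF w(1), of r "ball 0 (s * r)"] r by (simp add: pre)
  have "W13 (ball 0 2) M ?w (\<lambda>x. frechet_derivative ?w (at x))"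
    using w(2) by (intro W13_of_C1 C1_scale w(1)) auto
  moreover have "smith_equation UNIV (\<bullet>) standard_orientation (J (?w x)) (frechet_derivative ?w (at x))" for x
    unfolding frechet_derivative_scale[OF w(1)]
    using w(1) by (intro smith_equation_scale[OF r] smith linear_frechet_derivative) simp
  ultimately have "W13_smith_map (ball 0 2) (\<lambda>_. mat 1) M J ?w (\<lambda>x. frechet_derivative ?w (at x))"
    by (simp add: W13_smith_map_def flat_metric(1))
  moreover have "euclidean_energy (ball 0 2) (\<lambda>x. frechet_derivative ?w (at x)) < ennreal \<epsilon>"
  proof -
    have "euclidean_energy (ball 0 (2 * r)) (\<lambda>x. frechet_derivative w (at x))
        \<le> euclidean_energy UNIV (\<lambda>x. frechet_derivative w (at x))"
      by (simp add: euclidean_energy_eq[OF w(1)]) (intro nn_integral_mono, simp split: split_indicator)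
    then show ?thesis using small by (simp add: scale)
  qed
  moreover have "C1_distance_to_euclidean (ball 0 2) (\<lambda>_. mat 1) \<le> ennreal \<epsilon>"
    using flat_metric(3)[of "ball 0 2"] by simp
  ultimately have "euclidean_energy (ball 0 \<theta>) (\<lambda>x. frechet_derivative ?w (at x))
     \<le> ennreal (\<theta> powr (3 * \<alpha>)) * euclidean_energy (ball 0 2) (\<lambda>x. frechet_derivative ?w (at x))"
    using decay flat_metric(2) unfolding energy_decay_pair_def by blast
  then show ?thesis by (simp only: scale)
qed

text \<open>A Liouville theorem. Since the bound holds at every scale, the energy of a ball is at most
  \<open>q\<close> times that of a larger concentric ball, and repeating this \<open>n\<close>
  times leaves \<open>q ^ n\<close> times the finite total energy.\<close>

lemma smith_map_R3_derivative_eq_0: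
  fixes w :: "real^3 \<Rightarrow> 'b::euclidean_space"
  assumes decay: "energy_decay_pair M J \<alpha> \<epsilon> \<theta>" and \<alpha>: "0 < \<alpha>"
    and w: "Ck_open (Suc 0) UNIV w" "range w \<subseteq> M"
    and smith: "\<And>x. smith_equation UNIV (\<bullet>) standard_orientation (J (w x)) (frechet_derivative w (at x))"
    and small: "euclidean_energy UNIV (\<lambda>x. frechet_derivative w (at x)) < ennreal \<epsilon>"
  shows "frechet_derivative w (at x) v = 0"
proof -
  define E where "E r = euclidean_energy (ball 0 r) (\<lambda>x. frechet_derivative w (at x))" for r
  define T where "T = enn2real (euclidean_energy UNIV (\<lambda>x. frechet_derivative w (at x)))"
  define q where "q = \<theta> powr (3 * \<alpha>)"
  have \<theta>: "0 < \<theta>" "\<theta> < 1" using decay by (auto simp: energy_decay_pair_def)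
  have q: "0 \<le> q" "q < 1" using \<theta> \<alpha> by (auto simp: q_def powr01_less_one)
  have T: "ennreal T = euclidean_energy UNIV (\<lambda>x. frechet_derivative w (at x))" "0 \<le> T"
    using small by (auto simp: T_def intro!: ennreal_enn2real less_trans[OF small])
  have bound: "E r \<le> ennreal (q ^ n * T)" if "0 < r" for n r
    using that
  proof (induction n arbitrary: r)
    case 0
    have "E r \<le> ennreal T"
      unfolding T(1) E_def
      by (simp add: euclidean_energy_eq[OF w(1)]) (intro nn_integral_mono, simp split: split_indicator)
    then show ?case by simp
  next
    case (Suc n)
    \<comment> \<open>The decay estimate at radius \<open>r / \<theta>\<close>, whose inner ball has radius \<open>r\<close>.\<close>
    have "E r \<le> ennreal q * E (2 * (r / \<theta>))"
      using smith_map_R3_energy_decay[OF decay w smith small, of "r / \<theta>"] Suc.prems \<theta>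
      by (simp add: E_def q_def)
    also have "\<dots> \<le> ennreal q * ennreal (q ^ n * T)"
      using Suc.IH[of "2 * (r / \<theta>)"] Suc.prems \<theta> by (intro mult_left_mono) auto
    also have "\<dots> = ennreal (q ^ Suc n * T)"
      using q T(2) by (simp add: ennreal_mult'[symmetric] mult.assoc)
    finally show ?case .
  qed
  have E0: "E r = 0" if "0 < r" for r
  proof -
    have "(\<lambda>n. ennreal (q ^ n * T)) \<longlonglongrightarrow> ennreal (0 * T)"
      using q by (intro tendsto_ennrealI tendsto_mult LIMSEQ_realpow_zero tendsto_const)
    then have "E r \<le> ennreal (0 * T)"
      by (rule LIMSEQ_le_const) (use bound[OF that] in auto)
    then show ?thesis by simp
  qed
  define r where "r = norm x + 1"
  have "0 < r" "x \<in> ball 0 r" by (simp_all add: r_def add_nonneg_pos)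
  \<comment> \<open>A continuous density with integral 0 over a ball vanishes in it, since its support there is open and null.\<close>
  have "energy_density w x = 0"
  proof (rule ccontr)
    assume ne: "energy_density w x \<noteq> 0"
    let ?S = "ball 0 r \<inter> {y. energy_density w y \<noteq> 0}"
    have "open {y. energy_density w y \<noteq> 0}"
      by (intro open_Collect_neq continuous_on_energy_density w(1) continuous_on_const)
    then have "open ?S" by auto
    have nonneg: "0 \<le> energy_density w y" for y
      by (simp add: energy_density_eq[OF w(1)] sum_nonneg)
    have "(\<integral>\<^sup>+y. ennreal (energy_density w y) * indicator (ball 0 r) y \<partial>lborel) = 0"
      using E0[OF \<open>0 < r\<close>] by (simp add: E_def euclidean_energy_eq[OF w(1)])
    then have "AE y in lborel. ennreal (energy_density w y) * indicator (ball 0 r) y = 0"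
      using borel_measurable_times_ennreal[OF energy_density_measurable[OF w(1)]
        borel_measurable_indicator[of "ball 0 r" borel]]
      by (subst (asm) nn_integral_0_iff_AE) auto
    then have "AE y in lborel. y \<notin> ?S"
    proof eventually_elim
      case (elim y)
      show ?case
      proof
        assume "y \<in> ?S"
        then have "ennreal (energy_density w y) = 0" "energy_density w y \<noteq> 0" using elim by auto
        then show False using nonneg[of y] by (metis antisym ennreal_eq_0_iff)
      qed
    qed
    then have "?S \<in> null_sets lborel"
      using \<open>open ?S\<close> by (subst AE_iff_null_sets) auto
    then have "negligible ?S"
      by (simp add: negligible_iff_null_sets null_sets_completionI)
    moreover have "?S \<noteq> {}" using ne \<open>x \<in> ball 0 r\<close> by blast
    ultimately show False using open_not_negligible[OF \<open>open ?S\<close>] by blast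
  qed
  then have "(\<Sum>i\<in>UNIV. (norm (frechet_derivative w (at x) (axis i 1)))\<^sup>2) = 0"
    by (simp add: energy_density_eq[OF w(1)])
  then have z: "frechet_derivative w (at x) (axis i 1) = 0" for i
    by (simp add: sum_nonneg_eq_0_iff)
  have "linear (frechet_derivative w (at x))"
    using w(1) by (intro linear_frechet_derivative) simp
  moreover have "v = (\<Sum>i\<in>UNIV. v$i *\<^sub>R axis i 1)"
    by (simp add: vec_eq_iff axis_def if_distrib if_distribR cong: if_cong)
  ultimately show ?thesis
    using z by (metis (no_types, lifting) linear_sum linear_scale scaleR_zero_right sum.neutral)
qed


section \<open>Smith maps on the sphere\<close>

text \<open>Here \<open>s\<close> is the sign with which the stereographic parametrization meets the
  orientation of the sphere. Composing with multiplication by \<open>s\<close>, of determinant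
  \<open>s\<^sup>3 = s\<close>, makes the parametrization positive.\<close>

lemma smith_map_sphere_pullback:
  fixes u :: "real^4 \<Rightarrow> 'b::euclidean_space"
  assumes ori: "\<And>x. oS (stereo x) = {\<lambda>i. stereo_derivative x (column i A) | A :: real^3^3. 0 < s * det A}"
    and s: "s = 1 \<or> s = - 1" and smith: "C1_smith_map (sphere 0 1) oS M J u"
  shows "smith_equation UNIV (\<bullet>) standard_orientation (J (u (stereo (s *\<^sub>R x))))
      (frechet_derivative (\<lambda>x. u (stereo (s *\<^sub>R x))) (at x))"
proof -
  let ?p = "stereo (s *\<^sub>R x)"
  let ?D = "differential (sphere 0 1) u ?p"
  let ?H = "\<lambda>v::real^3. s *\<^sub>R v"
  let ?L = "\<lambda>v. stereo_derivative (s *\<^sub>R x) (s *\<^sub>R v)"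
  interpret stereo: conformal_linear "stereo_derivative (s *\<^sub>R x)" "conformal_factor (s *\<^sub>R x)"
    by (rule conformal_stereo)
  have H: "linear ?H" by (rule linear_scaleR)
  have ss: "s * s = 1" using s by auto
  interpret conformal_linear ?L "conformal_factor (s *\<^sub>R x)"
  proof (rule conformal_linear.intro)
    show "linear ?L" using linear_compose[OF H stereo.linear] by (simp add: o_def)
    show "0 < conformal_factor (s *\<^sub>R x)" by (rule conformal_factor_pos)
    show "?L v \<bullet> ?L w = (conformal_factor (s *\<^sub>R x))\<^sup>2 * (v \<bullet> w)" for v w
      by (simp add: stereo.inner mult.assoc[symmetric] ss)
  qed
  have d: "det (matrix ?H) = s"
    using s by (auto simp: det_3 matrix_def axis_def)
  have P: "oS ?p = {\<lambda>i. ?L (column i A) | A :: real^3^3. 0 < det A}"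
  proof -
    have "{\<lambda>i. stereo_derivative (s *\<^sub>R x) (column i A) | A :: real^3^3. 0 < s * det A} =
        {\<lambda>i. ?L (column i A) | A :: real^3^3. 0 < det A}"
    proof (intro equalityI subsetI; clarsimp)
      fix A :: "real^3^3" assume "0 < s * det A"
      show "\<exists>B. (\<lambda>i. stereo_derivative (s *\<^sub>R x) (column i A)) = (\<lambda>i. ?L (column i B)) \<and> 0 < det B"
      proof (intro exI[of _ "s *\<^sub>R A"] conjI ext)
        have "s *\<^sub>R column i (s *\<^sub>R A) = column i A" for i
          by (simp add: column_def vec_eq_iff mult.assoc[symmetric] ss)
        then show "stereo_derivative (s *\<^sub>R x) (column i A) = ?L (column i (s *\<^sub>R A))" for i by simp
        show "0 < det (s *\<^sub>R A)" using s \<open>0 < s * det A\<close> by (auto simp: det_3)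
      qed
    next
      fix A :: "real^3^3" assume "0 < det A"
      then show "\<exists>B. (\<lambda>i. ?L (column i A)) = (\<lambda>i. stereo_derivative (s *\<^sub>R x) (column i B)) \<and> 0 < s * det B"
        using s by (intro exI[of _ "matrix ?H ** A"])
          (auto simp: matrix_mult_column[OF H] det_mul d mult.assoc[symmetric])
    qed
    then show ?thesis using ori by simp
  qed
  have R: "range ?L = tangent_space (sphere 0 1) ?p"
  proof -
    have "surj ?H" using ss by (metis surjI scaleR_scaleR scaleR_one)
    then show ?thesis
      unfolding tangent_space_sphere by (metis image_image)
  qed
  have C1: "Ck_map 1 (sphere 0 1) u" using smith by (simp add: C1_smith_map_def)
  note pullback = C1_pullback[OF C1 Ck_open_stereo, OF image_subsetI, OF stereo_in_sphere]
  have "smith_equation (tangent_space (sphere 0 1) ?p) (\<bullet>) (oS ?p) (J (u ?p)) ?D"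
    using smith stereo_in_sphere unfolding C1_smith_map_def by blast
  then have "smith_equation UNIV (\<bullet>) standard_orientation (J (u ?p)) (\<lambda>v. ?D (?L v))"
    unfolding R[symmetric] by (rule smith_equation_pullback[OF P pullback(2)])
  moreover have "frechet_derivative (\<lambda>x. u (stereo (s *\<^sub>R x))) (at x) = (\<lambda>v. ?D (?L v))"
    using frechet_derivative_scale[OF pullback(1), of s x] pullback(3)
    by (simp add: fun_eq_iff frechet_derivative_stereo)
  ultimately show ?thesis by simp
qed

lemma sphere_height_1: "p \<in> sphere 0 1 \<Longrightarrow> p$4 = 1 \<Longrightarrow> p = pole"
proof -
  assume "p \<in> sphere 0 1" and 4: "p$4 = 1"
  then have "p \<bullet> p = 1" by (simp add: norm_eq_1)
  then have "p$1 * p$1 + p$2 * p$2 + p$3 * p$3 = 0" using 4 by (simp add: inner_vec_def sum_4)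
  then have "p$1 = 0" "p$2 = 0" "p$3 = 0"
    by (smt (verit) mult_eq_0_iff zero_le_square)+
  then show "p = pole" using 4 by (simp add: vec_eq_iff forall_4 pole_nth)
qed

text \<open>The pole is not isolated in the sphere, because the sphere is connected.\<close>

lemma sphere_subset_closure_range_stereo: "sphere 0 1 \<subseteq> closure (range stereo)"
proof
  fix p :: "real^4" assume p: "p \<in> sphere 0 1"
  show "p \<in> closure (range stereo)"
  proof (cases "p$4 = 1")
    case False
    then show ?thesis using p range_stereo closure_subset by blast
  next
    case True
    then have pole: "p = pole" using sphere_height_1[OF p] by simp
    have "connected (sphere (0::real^4) 1)" by (rule connected_sphere) simp
    moreover have "stereo 0 \<in> sphere 0 1" "stereo 0 \<noteq> p"
      using stereo_in_sphere[of 0] range_stereo True by auto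
    ultimately have "p islimpt sphere 0 1"
      using connected_imp_perfect[of "sphere (0::real^4) 1" p] p by (metis singletonD)
    moreover have "sphere 0 1 - {p} \<subseteq> range stereo"
      using sphere_height_1 pole unfolding range_stereo by blast
    ultimately show ?thesis
      by (metis islimpt_punctured islimpt_subset closure_def UnI2 mem_Collect_eq)
  qed
qed

text \<open>The norm of the differential of \<open>u\<close> is that of the pullback divided by the
  conformal factor, and its cube compensates the volume density.\<close>

lemma euclidean_energy_pullback_le:
  fixes u :: "real^4 \<Rightarrow> 'b::euclidean_space"
  assumes \<mu>: "volume_measure3 (sphere 0 1) \<mu>" and u: "Ck_map 1 (sphere 0 1) u"
  shows "euclidean_energy UNIV (\<lambda>x. frechet_derivative (\<lambda>x. u (stereo x)) (at x)) \<le>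
    (\<integral>\<^sup>+x. ennreal (hs_norm (tangent_space (sphere 0 1) x) (\<bullet>) (differential (sphere 0 1) u x) ^ 3) \<partial>\<mu>)"
proof -
  let ?U = "\<lambda>x. u (stereo x)"
  let ?f = "\<lambda>p. ennreal (hs_norm (tangent_space (sphere 0 1) p) (\<bullet>) (differential (sphere 0 1) u p) ^ 3)"
  note pullback = C1_pullback[OF u Ck_open_stereo, OF image_subsetI, OF stereo_in_sphere]
  have hs: "hs_norm (tangent_space (sphere 0 1) (stereo x)) (\<bullet>) (differential (sphere 0 1) u (stereo x)) ^ 3
      = energy_density ?U x / conformal_factor x ^ 3" for x
    unfolding tangent_space_sphere energy_density_eq[OF pullback(1)]
      conformal_linear.hs_norm_eq[OF conformal_stereo pullback(2)] pullback(3)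
    by (simp add: frechet_derivative_stereo power_divide)
  have "continuous_on UNIV (\<lambda>x. energy_density ?U x / conformal_factor x ^ 3)"
    using conformal_factor_pos Ck_open_conformal_factor[of 0]
    by (intro continuous_on_divide continuous_on_energy_density pullback(1) continuous_on_power)
       (auto simp: less_imp_neq[symmetric])
  then have "(\<lambda>x. ?f (stereo x)) \<in> borel_measurable borel"
    unfolding hs by (intro measurable_compose[OF _ measurable_ennreal] borel_measurable_continuous_onI)
  from energy_stereo_le[OF \<mu> this]
  have "(\<integral>\<^sup>+x. ennreal (conformal_factor x ^ 3) * ?f (stereo x) \<partial>lborel) \<le> (\<integral>\<^sup>+p. ?f p \<partial>\<mu>)" .
  moreover have "ennreal (conformal_factor x ^ 3) * ?f (stereo x) = ennreal (energy_density ?U x)" for x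
    unfolding hs using conformal_factor_pos[of x]
    by (subst ennreal_mult'[symmetric]) simp_all
  ultimately show ?thesis
    by (simp add: euclidean_energy_eq[OF pullback(1)])
qed

theorem proposition4p17:
  fixes M :: "(real^'d) set"
    and oM :: "real^'d \<Rightarrow> (7 \<Rightarrow> real^'d) set"
    and J :: "real^'d \<Rightarrow> real^'d \<Rightarrow> real^'d \<Rightarrow> real^'d"
    and \<alpha> \<epsilon>\<^sub>0 \<theta> :: real
    and oS :: "real^4 \<Rightarrow> (3 \<Rightarrow> real^4) set"
    and \<mu> :: "(real^4) measure"
    and u :: "real^4 \<Rightarrow> real^'d"
  assumes "compact M" and "submanifold TYPE(7) M" and "orientation M oM"
    and "vector_cross_product M J"
    and "3/4 < \<alpha>" and "\<alpha> < 1" and "energy_decay_pair M J \<alpha> \<epsilon>\<^sub>0 \<theta>"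
    and "orientation (sphere 0 1) oS"
    and "volume_measure3 (sphere 0 1) \<mu>"
    and "C1_smith_map (sphere 0 1) oS M J u"
    and "(\<integral>\<^sup>+x. ennreal (hs_norm (tangent_space (sphere 0 1) x) (\<bullet>) (differential (sphere 0 1) u x) ^ 3) \<partial>\<mu>)
           < ennreal \<epsilon>\<^sub>0"
  shows "u constant_on sphere 0 1"
proof -
  note decay = assms(7) and smith = assms(10)
  have u: "Ck_map 1 (sphere 0 1) u" and uM: "u ` sphere 0 1 \<subseteq> M"
    by (rule smith[unfolded C1_smith_map_def, THEN conjunct2, THEN conjunct1]
          smith[unfolded C1_smith_map_def, THEN conjunct1])+
  obtain s :: real where s: "s = 1 \<or> s = - 1" and ori:
    "\<forall>x. oS (stereo x) = {\<lambda>i. stereo_derivative x (column i A) | A :: real^3^3. 0 < s * det A}"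
    by (rule orientation_along_immersion[OF assms(8) Ck_open_stereo image_subsetI[OF stereo_in_sphere],
          unfolded frechet_derivative_stereo, OF conformal_linear.inj[OF conformal_stereo]])
  define w where "w x = u (stereo (s *\<^sub>R x))" for x
  have U: "Ck_open (Suc 0) UNIV (\<lambda>x. u (stereo x))"
    using C1_pullback(1)[OF u Ck_open_stereo] stereo_in_sphere by blast
  have w: "Ck_open (Suc 0) UNIV w" unfolding w_def by (rule C1_scale[OF U])
  have wM: "range w \<subseteq> M" using uM stereo_in_sphere unfolding w_def by blast
  have "euclidean_energy UNIV (\<lambda>x. frechet_derivative w (at x))
      = euclidean_energy UNIV (\<lambda>x. frechet_derivative (\<lambda>x. u (stereo x)) (at x))"
    using euclidean_energy_scale[OF U, of s UNIV] s unfolding w_def by auto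
  then have small: "euclidean_energy UNIV (\<lambda>x. frechet_derivative w (at x)) < ennreal \<epsilon>\<^sub>0"
    using le_less_trans[OF euclidean_energy_pullback_le[OF assms(9) u]
      assms(11)] by simp
  have "frechet_derivative w (at x) v = 0" for x v
  proof (rule smith_map_R3_derivative_eq_0[OF decay _ w wM _ small])
    show "0 < \<alpha>" using assms(5) by simp
    show "smith_equation UNIV (\<bullet>) standard_orientation (J (w x)) (frechet_derivative w (at x))" for x
      unfolding w_def by (rule smith_map_sphere_pullback[OF _ s smith]) (use ori in blast)
  qed
  then have "(w has_derivative (\<lambda>_. 0)) (at x)" for x
    using Ck_open_has_derivative[OF w UNIV_I, of x] by (metis (no_types, lifting) ext)
  then obtain c where c: "\<And>x. w x = c"
    using has_derivative_zero_constant[OF convex_UNIV, of w] by auto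
  have range: "u p = c" if "p \<in> range stereo" for p
  proof -
    \<comment> \<open>As \<open>s * s = 1\<close>, every point of the range of \<open>stereo\<close> is a value of the twisted parametrization.\<close>
  obtain x where "p = stereo (s *\<^sub>R (s *\<^sub>R x))" using \<open>p \<in> range stereo\<close> s by auto
    then show ?thesis using c[of "s *\<^sub>R x"] by (simp only: w_def)
  qed
  have "closure (range stereo) \<subseteq> sphere 0 1"
    using stereo_in_sphere by (intro closure_minimal) auto
  then have cont: "continuous_on (closure (range stereo)) u"
    using Ck_map_imp_continuous_on[OF u order_refl] continuous_on_subset by blast
  have "u p = c" if "p \<in> sphere 0 1" for p
    by (rule continuous_constant_on_closure[OF cont])
       (use range sphere_subset_closure_range_stereo that in auto)
  then show ?thesis unfolding constant_on_def by blast
qed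

end
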